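(* Let $(\Omega,\mathcal{F},\Pr)$ be a probability space, let $(\mathsf{X},\mathcal{X})$ and $(\mathsf{Y},\mathcal{Y})$ be arbitrary measurable spaces, let $(X,Y):\Omega\to\mathsf{X}\times\mathsf{Y}$ be a pair of random variables, and suppose that $p(y\mid x)$ is a conditional density of $Y$ given $X$ with respect to a measure $\nu:\mathcal{Y}\to[0,\infty]$ (not necessarily $\sigma$-finite). Then the following are equivalent: (a) $X$ and $Y$ satisfy the following (mutually equivalent) conditions: (1) $X$ and $Y$ have a joint density with respect to a product measure $\mu\times\nu_0$ for some measures $\mu$ on $\mathcal{X}$ and $\nu_0$ on $\mathcal{Y}$; (2) $P_{X,Y}\ll P_X\times P_Y$; (3) $X$ has a conditional density given $Y$ with respect to some $\sigma$-finite measure $\mu$; (4) $X$ has a conditional distribution $P_{X\mid Y}$ given $Y$ such that $P_{X\mid y}\ll P_X$ for all $y\in\mathsf{Y}$; (5) $X$ has a conditional distribution $P_{X\mid Y}$ given $Y$ and a marginal density with respect to some measure $\mu$ such that $P_{X\mid y}\ll\mu$ for all $y\in\mathsf{Y}$. (b) There exists a measurable subset $V\subset\mathsf{Y}$ such that the measure $\nu'(B):=\nu(B\cap V)$, $B\in\mathcal{Y}$, is $\sigma$-finite, $p(y\mid x)$ is a conditional density of $Y$ given $X$ with respect to $\nu'$, and $$p(y):=\int p(y\mid x)\,dP_X(x)$$ is a marginal density of $Y$ with respect to $\nu'$. (c) Bayes' formula $$P_{X\mid y}(S):=\frac{\int_S p(y\mid x)\,dP_X(x)}{\int p(y\mid x)\,dP_X(x)},\qquad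 S\in\mathcal{X},\ y\in\mathsf{Y},$$ defines a conditional distribution of $X$ given $Y$. (c') If $p(x)$ is a marginal density of $X$ with respect to a measure $\mu$ on $\mathcal{X}$ (for any such $\mu$ and $p(x)$), then $$p(x\mid y):=\frac{p(y\mid x)\,p(x)}{\int p(y\mid x)\,p(x)\,d\mu(x)}$$ is a conditional density of $X$ given $Y$ with respect to $\mu$. Moreover, in (b), if $\nu$ is semifinite (for every $B\in\mathcal{Y}$ with $\nu(B)>0$ there exists a measurable $B'\subset B$ such that $0<\nu(B')<\infty$), then $p(y)$ is a density of $Y$ with respect to the original measure $\nu$, too.
   Context: A random variable is a measurable map from the probability space $(\Omega,\mathcal{F},\Pr)$ to some measurable space. The distribution of $X:\Omega\to\mathsf{X}$ is the measure $P_X(S)=\Pr(X^{-1}(S))$, $S\in\mathcal{X}$; $P_{X,Y}$ is the distribution of $(X,Y)$ on $\mathcal{X}\otimes\mathcal{Y}$, the $\sigma$-algebra generated by all measurable rectangles. Density: a measurable function $p:\mathsf{X}\to[0,\infty]$ is a density of $X$ with respect to a measure $\mu:\mathcal{X}\to[0,\infty]$ if $P_X(S)=\int_S p\,d\mu$ for all $S\in\mathcal{X}$. A joint density of $X$ and $Y$ is a density of $(X,Y)$; a marginal density of $X$ is a density of $X$. Product of arbitrary measures: for arbitrary measures $\mu:\mathcal{X}\to[0,\infty]$ and $\nu:\mathcal{Y}\to[0,\infty]$, the measure $\mu\times\nu:\mathcal{X}\otimes\mathcal{Y}\to[0,\infty]$ is defined by $$(\mu\times\nu)(S)=\inf\Big\{\sum_{k=1}^\infty\mu(A_k)\nu(B_k):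 A_k\in\mathcal{X},\ B_k\in\mathcal{Y},\ S\subset\bigcup_{k=1}^\infty A_k\times B_k\Big\},$$ with the usual convention $0\cdot\infty=0$. Transition measure: a function $\kappa:\mathsf{Y}\times\mathcal{X}\to[0,\infty]$ such that $S\mapsto\kappa(y,S)$ is a measure on $\mathcal{X}$ for every $y\in\mathsf{Y}$ and $y\mapsto\kappa(y,S)$ is $\mathcal{Y}$-measurable for every $S\in\mathcal{X}$. Its product with a $\sigma$-finite measure $\nu$ on $\mathcal{Y}$ is $(\kappa\times\nu)(S)=\int\kappa(y,S_y)\,d\nu(y)$ for $S\in\mathcal{X}\otimes\mathcal{Y}$, where $S_y=\{x:(x,y)\in S\}$. Conditional distribution: a transition measure $P_{X\mid Y}:\mathsf{Y}\times\mathcal{X}\to[0,\infty]$ with $P_{X,Y}=P_{X\mid Y}\times P_Y$ is called a conditional distribution of $X$ given $Y$; write $P_{X\mid y}=P_{X\mid Y}(y,\cdot)$. (It is not required that every $P_{X\mid y}$ be a probability measure; existence is not automatic in arbitrary measurable spaces.) Conditional density: a jointly measurable nonnegative (possibly extended-valued) function $(x,y)\mapsto p(x\mid y)$ is a conditional density of $X$ given $Y$ with respect to a measure $\mu$ on $\mathcal{X}$ if there is a conditional distribution $P_{X\mid Y}$ with $P_{X\mid y}(S)=\int_S p(x\mid y)\,d\mu(x)$ for all $S\in\mathcal{X}$ and all $y\in\mathsf{Y}$. Conditional distributions and densities of $Y$ given $X$ are defined in the same way with the roles reversed. Convention: in Bayes' formula in (c) and (c'), the quotient is set equal to $0$ for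 those $y$ for which the denominator is $0$ or $\infty$. *)

theory Defs
  imports "HOL-Probability.Probability"
begin

text \<open>
  Throughout, a measurable space is given by a measure \<open>MX\<close> of which only
  \<open>space\<close> and \<open>sets\<close> are used, and ``\<open>\<mu>\<close> is a measure on \<open>MX\<close>'' is
  \<open>sets \<mu> = sets MX\<close>.  Densities of random variables are the library's
  \<^const>\<open>distributed\<close>, which puts no \<open>\<sigma>\<close>-finiteness condition on the reference measure.
\<close>

section \<open>Product of arbitrary measures\<close>

definition rect_cover :: "'a measure \<Rightarrow> 'b measure \<Rightarrow> ('a \<times> 'b) set \<Rightarrow>
    ((nat \<Rightarrow> 'a set) \<times> (nat \<Rightarrow> 'b set)) set" where
  "rect_cover \<mu> \<nu> S =
     {(A, B). range A \<subseteq> sets \<mu> \<and> range B \<subseteq> sets \<nu> \<and> S \<subseteq> (\<Union>k. A k \<times> B k)}"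

definition rect_outer :: "'a measure \<Rightarrow> 'b measure \<Rightarrow> ('a \<times> 'b) set \<Rightarrow> ennreal" where
  "rect_outer \<mu> \<nu> S =
     (INF (A, B) \<in> rect_cover \<mu> \<nu> S. \<Sum>k. emeasure \<mu> (A k) * emeasure \<nu> (B k))"

text \<open>
  The library's \<open>\<mu> \<Otimes>\<^sub>M \<nu>\<close> is an iterated integral, which is the intended product only for
  \<open>\<sigma>\<close>-finite measures; it is used below only for its \<open>\<sigma>\<close>-algebra.
  Lemma \<open>emeasure_arb_prod\<close> shows that \<^const>\<open>measure_of\<close> does not degenerate here.
\<close>

definition arb_prod :: "'a measure \<Rightarrow> 'b measure \<Rightarrow> ('a \<times> 'b) measure" where
  "arb_prod \<mu> \<nu> = measure_of (space \<mu> \<times> space \<nu>) (sets (\<mu> \<Otimes>\<^sub>M \<nu>)) (rect_outer \<mu> \<nu>)"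

lemma space_arb_prod: "space (arb_prod \<mu> \<nu>) = space \<mu> \<times> space \<nu>"
  unfolding arb_prod_def
  using sets.space_closed[of "\<mu> \<Otimes>\<^sub>M \<nu>"] by (simp add: space_pair_measure)

lemma sets_arb_prod: "sets (arb_prod \<mu> \<nu>) = sets (\<mu> \<Otimes>\<^sub>M \<nu>)"
  unfolding arb_prod_def
  using sets.sets_measure_of_eq[of "\<mu> \<Otimes>\<^sub>M \<nu>"] by (simp add: space_pair_measure)

lemma rect_outer_le:
  assumes "range A \<subseteq> sets \<mu>" "range B \<subseteq> sets \<nu>" "S \<subseteq> (\<Union>k. A k \<times> B k)"
  shows "rect_outer \<mu> \<nu> S \<le> (\<Sum>k. emeasure \<mu> (A k) * emeasure \<nu> (B k))"
  unfolding rect_outer_def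
  by (rule INF_lower2[of "(A, B)"]) (use assms in \<open>auto simp: rect_cover_def\<close>)

lemma rect_outer_mono: "S \<subseteq> T \<Longrightarrow> rect_outer \<mu> \<nu> S \<le> rect_outer \<mu> \<nu> T"
  unfolding rect_outer_def by (rule INF_superset_mono) (auto simp: rect_cover_def)

lemma rect_outer_empty: "rect_outer \<mu> \<nu> {} = 0"
  using rect_outer_le[of "\<lambda>_. {}" \<mu> "\<lambda>_. {}" \<nu> "{}"] by simp

lemma rect_outer_close:
  assumes "rect_outer \<mu> \<nu> S < e"
  shows "\<exists>A B. range A \<subseteq> sets \<mu> \<and> range B \<subseteq> sets \<nu> \<and> S \<subseteq> (\<Union>k. A k \<times> B k) \<and>
           (\<Sum>k. emeasure \<mu> (A k) * emeasure \<nu> (B k)) < e"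
  using assms unfolding rect_outer_def INF_less_iff by (auto simp: rect_cover_def)

lemma rect_outer_UN:
  fixes S :: "nat \<Rightarrow> ('a \<times> 'b) set"
  shows "rect_outer \<mu> \<nu> (\<Union>n. S n) \<le> (\<Sum>n. rect_outer \<mu> \<nu> (S n))"
proof (rule ennreal_le_epsilon)
  let ?O = "rect_outer \<mu> \<nu>"
  fix e :: real
  assume "0 < e" "(\<Sum>n. ?O (S n)) < top"
  then have *: "\<And>n. ?O (S n) < ?O (S n) + e * (1/2)^Suc n"
    by (auto simp add: less_top dest!: ennreal_suminf_lessD)
  have "\<forall>n. \<exists>P. range (fst P) \<subseteq> sets \<mu> \<and> range (snd P) \<subseteq> sets \<nu> \<and>
      S n \<subseteq> (\<Union>k. fst P k \<times> snd P k) \<and>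
      (\<Sum>k. emeasure \<mu> (fst P k) * emeasure \<nu> (snd P k)) < ?O (S n) + e * (1/2)^Suc n"
    (is "\<forall>n. \<exists>P. ?Q n P")
  proof
    fix n
    obtain A B where "range A \<subseteq> sets \<mu>" "range B \<subseteq> sets \<nu>" "S n \<subseteq> (\<Union>k. A k \<times> B k)"
      "(\<Sum>k. emeasure \<mu> (A k) * emeasure \<nu> (B k)) < ?O (S n) + e * (1/2)^Suc n"
      using rect_outer_close[OF *[of n]] by (elim exE conjE)
    then have "?Q n (A, B)"
      by (simp only: fst_conv snd_conv simp_thms)
    then show "\<exists>P. ?Q n P" ..
  qed
  from choice[OF this] obtain P where P: "\<forall>n. ?Q n (P n)" ..
  define A B where "A n = fst (P n)" and "B n = snd (P n)" for n
  note Q = P[rule_format, folded A_def B_def]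
  note A = Q[THEN conjunct1] and B = Q[THEN conjunct2, THEN conjunct1]
    and sub = Q[THEN conjunct2, THEN conjunct2, THEN conjunct1]
    and less = Q[THEN conjunct2, THEN conjunct2, THEN conjunct2]
  define A' where "A' k = case_prod A (prod_decode k)" for k
  define B' where "B' k = case_prod B (prod_decode k)" for k
  have "?O (\<Union>n. S n) \<le> (\<Sum>k. emeasure \<mu> (A' k) * emeasure \<nu> (B' k))"
  proof (rule rect_outer_le)
    show "range A' \<subseteq> sets \<mu>" "range B' \<subseteq> sets \<nu>"
      using A B by (auto simp: A'_def B'_def split_def)
    show "(\<Union>n. S n) \<subseteq> (\<Union>k. A' k \<times> B' k)"
    proof
      fix z assume "z \<in> (\<Union>n. S n)"
      then obtain n k where "z \<in> A n k \<times> B n k" using sub by blast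
      then have "z \<in> A' (prod_encode (n, k)) \<times> B' (prod_encode (n, k))"
        by (simp add: A'_def B'_def)
      then show "z \<in> (\<Union>k. A' k \<times> B' k)" by blast
    qed
  qed
  also have "\<dots> = (\<Sum>k. ((\<lambda>(n, k). emeasure \<mu> (A n k) * emeasure \<nu> (B n k)) \<circ> prod_decode) k)"
    by (simp add: A'_def B'_def split_def)
  also have "\<dots> = (\<Sum>n. \<Sum>k. emeasure \<mu> (A n k) * emeasure \<nu> (B n k))"
    unfolding comp_def by (intro suminf_ennreal_2dimen) auto
  also have "\<dots> \<le> (\<Sum>n. ?O (S n) + e * (1/2) ^ Suc n)"
    using less by (intro suminf_le) (auto simp: less_imp_le)
  also have "\<dots> = (\<Sum>n. ?O (S n)) + (\<Sum>n. ennreal e * ennreal ((1/2) ^ Suc n))"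
    using \<open>0 < e\<close> by (subst suminf_add[symmetric])
      (auto simp del: ennreal_suminf_cmult simp add: ennreal_mult[symmetric])
  also have "\<dots> = (\<Sum>n. ?O (S n)) + e"
    unfolding ennreal_suminf_cmult
    by (subst suminf_ennreal_eq[OF zero_le_power power_half_series]) auto
  finally show "?O (\<Union>n. S n) \<le> (\<Sum>n. ?O (S n)) + e" .
qed

lemma rect_outer_Un: "rect_outer \<mu> \<nu> (S \<union> T) \<le> rect_outer \<mu> \<nu> S + rect_outer \<mu> \<nu> T"
proof -
  have "rect_outer \<mu> \<nu> (\<Union>n. binaryset S T n) \<le> (\<Sum>n. rect_outer \<mu> \<nu> (binaryset S T n))"
    by (rule rect_outer_UN)
  then show ?thesis
    by (simp add: UN_binaryset_eq suminf_binaryset_eq rect_outer_empty)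
qed

lemma rect_outer_space:
  "outer_measure_space (Pow (space \<mu> \<times> space \<nu>)) (rect_outer \<mu> \<nu>)"
  unfolding outer_measure_space_def positive_def increasing_def countably_subadditive_def
  by (simp add: rect_outer_empty rect_outer_mono rect_outer_UN)

lemma rect_in_lambda_system:
  assumes E: "E \<in> sets \<mu>" and F: "F \<in> sets \<nu>"
  shows "E \<times> F \<in> lambda_system (space \<mu> \<times> space \<nu>) (Pow (space \<mu> \<times> space \<nu>)) (rect_outer \<mu> \<nu>)"
proof -
  let ?O = "rect_outer \<mu> \<nu>"
  have "?O (S \<inter> (E \<times> F)) + ?O (S - E \<times> F) \<le> ?O S" for S
    unfolding rect_outer_def[of \<mu> \<nu> S]
  proof (rule INF_greatest, clarify)
    fix A B assume "(A, B) \<in> rect_cover \<mu> \<nu> S"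
    then have A: "\<And>k. A k \<in> sets \<mu>" and B: "\<And>k. B k \<in> sets \<nu>" and S: "S \<subseteq> (\<Union>k. A k \<times> B k)"
      by (auto simp: rect_cover_def)
    let ?m = "\<lambda>A B. \<lambda>k. emeasure \<mu> (A k) * emeasure \<nu> (B k)"
    let ?A1 = "\<lambda>k. A k \<inter> E" and ?A2 = "\<lambda>k. A k - E"
    let ?B1 = "\<lambda>k. B k \<inter> F" and ?B2 = "\<lambda>k. B k - F"
    have 1: "?O (S \<inter> (E \<times> F)) \<le> (\<Sum>k. ?m ?A1 ?B1 k)"
      by (rule rect_outer_le) (use A B E F in blast, use A B E F in blast, use S in blast)
    have 2: "?O (S \<inter> (E \<times> (- F))) \<le> (\<Sum>k. ?m ?A1 ?B2 k)"
      by (rule rect_outer_le) (use A B E F in blast, use A B E F in blast, use S in blast)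
    have 3: "?O (S \<inter> ((- E) \<times> UNIV)) \<le> (\<Sum>k. ?m ?A2 B k)"
      by (rule rect_outer_le) (use A B E F in blast, use A B E F in blast, use S in blast)
    have "?O (S - E \<times> F) = ?O ((S \<inter> (E \<times> (- F))) \<union> (S \<inter> ((- E) \<times> UNIV)))"
      by (rule arg_cong[where f = ?O]) auto
    also have "\<dots> \<le> (\<Sum>k. ?m ?A1 ?B2 k) + (\<Sum>k. ?m ?A2 B k)"
      using rect_outer_Un add_mono[OF 2 3] by (rule order_trans)
    finally have "?O (S \<inter> (E \<times> F)) + ?O (S - E \<times> F) \<le>
        (\<Sum>k. ?m ?A1 ?B1 k) + ((\<Sum>k. ?m ?A1 ?B2 k) + (\<Sum>k. ?m ?A2 B k))"
      using 1 by (intro add_mono)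
    also have "\<dots> = (\<Sum>k. ?m ?A1 ?B1 k + (?m ?A1 ?B2 k + ?m ?A2 B k))"
      by (simp only: suminf_add[OF summableI summableI])
    also have "\<dots> = (\<Sum>k. ?m A B k)"
    proof (rule suminf_cong)
      fix k
      have a: "emeasure \<mu> (A k) = emeasure \<mu> (A k \<inter> E) + emeasure \<mu> (A k - E)"
        using A[of k] E by (subst plus_emeasure) (auto intro!: arg_cong[where f = "emeasure \<mu>"])
      have b: "emeasure \<nu> (B k) = emeasure \<nu> (B k \<inter> F) + emeasure \<nu> (B k - F)"
        using B[of k] F by (subst plus_emeasure) (auto intro!: arg_cong[where f = "emeasure \<nu>"])
      show "?m ?A1 ?B1 k + (?m ?A1 ?B2 k + ?m ?A2 B k) = ?m A B k"
        by (simp only: a b distrib_left distrib_right ac_simps)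
    qed
    finally show "?O (S \<inter> (E \<times> F)) + ?O (S - E \<times> F) \<le> (\<Sum>k. ?m A B k)" .
  qed
  moreover have "?O S \<le> ?O (S \<inter> (E \<times> F)) + ?O (S - E \<times> F)" for S
    using rect_outer_Un[of \<mu> \<nu> "S \<inter> (E \<times> F)" "S - E \<times> F"] by (simp add: Int_Diff_Un)
  ultimately have "?O (S \<inter> (E \<times> F)) + ?O (S - E \<times> F) = ?O S" for S
    by (rule antisym)
  then show ?thesis
    using sets.sets_into_space[OF E] sets.sets_into_space[OF F]
    by (auto simp: algebra.lambda_system_eq[OF algebra_Pow])
qed

lemma emeasure_arb_prod:
  assumes "S \<in> sets (\<mu> \<Otimes>\<^sub>M \<nu>)"
  shows "emeasure (arb_prod \<mu> \<nu>) S = rect_outer \<mu> \<nu> S"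
proof -
  let ?\<Omega> = "space \<mu> \<times> space \<nu>"
  let ?L = "lambda_system ?\<Omega> (Pow ?\<Omega>) (rect_outer \<mu> \<nu>)"
  have L: "measure_space ?\<Omega> ?L (rect_outer \<mu> \<nu>)"
    by (rule sigma_algebra.caratheodory_lemma[OF sigma_algebra_Pow rect_outer_space])
  then have "sigma_algebra ?\<Omega> ?L"
    by (simp add: measure_space_def)
  then have "sets (\<mu> \<Otimes>\<^sub>M \<nu>) \<subseteq> ?L"
    unfolding sets_pair_measure
    by (rule sigma_algebra.sigma_sets_subset) (use rect_in_lambda_system in auto)
  moreover have "sigma_algebra ?\<Omega> (sets (\<mu> \<Otimes>\<^sub>M \<nu>))"
    using sets.sigma_algebra_axioms[of "\<mu> \<Otimes>\<^sub>M \<nu>"] by (simp add: space_pair_measure)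
  ultimately have "measure_space ?\<Omega> (sets (\<mu> \<Otimes>\<^sub>M \<nu>)) (rect_outer \<mu> \<nu>)"
    using L by (metis measure_down)
  then show ?thesis
    unfolding arb_prod_def measure_space_def
    using assms by (intro emeasure_measure_of_sigma) auto
qed


section \<open>Conditional distributions and densities\<close>

definition transition_measure :: "'y measure \<Rightarrow> 'x measure \<Rightarrow> ('y \<Rightarrow> 'x measure) \<Rightarrow> bool" where
  "transition_measure MY MX \<kappa> \<longleftrightarrow>
     (\<forall>y\<in>space MY. sets (\<kappa> y) = sets MX) \<and>
     (\<forall>S\<in>sets MX. (\<lambda>y. emeasure (\<kappa> y) S) \<in> borel_measurable MY)"

definition transition_prod :: "('y \<Rightarrow> 'x measure) \<Rightarrow> 'y measure \<Rightarrow> ('x \<times> 'y) set \<Rightarrow> ennreal" where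
  "transition_prod \<kappa> \<nu> S = (\<integral>\<^sup>+ y. emeasure (\<kappa> y) {x. (x, y) \<in> S} \<partial>\<nu>)"

text \<open>
  \<open>\<kappa>\<close> need not be \<open>\<sigma>\<close>-finite, so the section integrand in \<^const>\<open>transition_prod\<close> is not known to
  be measurable in general.  In the next definition it is: the equation for the whole space makes
  \<open>\<kappa> y\<close> finite for almost every \<open>y\<close>, so the integrand agrees almost everywhere
  with a measurable function.
\<close>

definition cond_distribution ::
  "'w measure \<Rightarrow> 'x measure \<Rightarrow> 'y measure \<Rightarrow> ('w \<Rightarrow> 'x) \<Rightarrow> ('w \<Rightarrow> 'y) \<Rightarrow> ('y \<Rightarrow> 'x measure) \<Rightarrow> bool"
where
  "cond_distribution M MX MY X Y \<kappa> \<longleftrightarrow>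
     transition_measure MY MX \<kappa> \<and>
     (\<forall>S\<in>sets (MX \<Otimes>\<^sub>M MY).
        emeasure (distr M (MX \<Otimes>\<^sub>M MY) (\<lambda>\<omega>. (X \<omega>, Y \<omega>))) S =
        transition_prod \<kappa> (distr M MY Y) S)"

text \<open>
  \<open>cond_density M MX MY X Y \<mu> p\<close>: \<open>p x y\<close>, read \<open>p(x | y)\<close>, is a conditional density of
  \<open>X\<close> given \<open>Y\<close> with respect to \<open>\<mu>\<close>.
\<close>

definition cond_density ::
  "'w measure \<Rightarrow> 'x measure \<Rightarrow> 'y measure \<Rightarrow> ('w \<Rightarrow> 'x) \<Rightarrow> ('w \<Rightarrow> 'y) \<Rightarrow>
   'x measure \<Rightarrow> ('x \<Rightarrow> 'y \<Rightarrow> ennreal) \<Rightarrow> bool"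
where
  "cond_density M MX MY X Y \<mu> p \<longleftrightarrow>
     sets \<mu> = sets MX \<and>
     (\<lambda>(x, y). p x y) \<in> borel_measurable (MX \<Otimes>\<^sub>M MY) \<and>
     (\<exists>\<kappa>. cond_distribution M MX MY X Y \<kappa> \<and>
        (\<forall>y\<in>space MY. \<forall>S\<in>sets MX. emeasure (\<kappa> y) S = (\<integral>\<^sup>+x\<in>S. p x y \<partial>\<mu>)))"

definition bayes_quotient :: "ennreal \<Rightarrow> ennreal \<Rightarrow> ennreal" where
  "bayes_quotient a b = (if b = 0 \<or> b = \<infinity> then 0 else a / b)"

text \<open>
  The requirements on the set \<open>V\<close>, for a conditional density \<open>p y x\<close>, read \<open>p(y | x)\<close>, of \<open>Y\<close>
  given \<open>X\<close>.  Here \<open>density \<nu> (indicator V)\<close> is the measure \<open>B \<mapsto> \<nu> (B \<inter> V)\<close>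
  (lemma \<open>emeasure_restricted\<close>).
\<close>

definition localizes_density ::
  "'w measure \<Rightarrow> 'x measure \<Rightarrow> 'y measure \<Rightarrow> ('w \<Rightarrow> 'x) \<Rightarrow> ('w \<Rightarrow> 'y) \<Rightarrow>
   'y measure \<Rightarrow> ('y \<Rightarrow> 'x \<Rightarrow> ennreal) \<Rightarrow> 'y set \<Rightarrow> bool"
where
  "localizes_density M MX MY X Y \<nu> p V \<longleftrightarrow>
     V \<in> sets MY \<and>
     (let \<nu>' = density \<nu> (indicator V) in
        sigma_finite_measure \<nu>' \<and>
        cond_density M MY MX Y X \<nu>' p \<and>
        distributed M \<nu>' Y (\<lambda>y. \<integral>\<^sup>+x. p y x \<partial>distr M MX X))"

text \<open>
  The library's locale \<open>semifinite_measure\<close> does not require positive measure of the subset,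
  so every measure satisfies it; hence the following definition.
\<close>

definition semifinite :: "'a measure \<Rightarrow> bool" where
  "semifinite \<nu> \<longleftrightarrow>
     (\<forall>B\<in>sets \<nu>. emeasure \<nu> B > 0 \<longrightarrow>
        (\<exists>B'\<in>sets \<nu>. B' \<subseteq> B \<and> 0 < emeasure \<nu> B' \<and> emeasure \<nu> B' < \<infinity>))"

end

theory Submission
  imports Defs
begin

text \<open>
  Write \<open>P\<close> for the joint distribution and \<open>PX\<close>, \<open>PY\<close> for its marginals.  All the conditions in (a)
  amount to \<open>P \<lless> PX \<Otimes> PY\<close>.  A density \<open>f\<close> of \<open>P\<close> with respect to \<open>PX \<Otimes> PY\<close>, given by
  Radon--Nikodym, is at once a joint density and a conditional density of \<open>X\<close> given \<open>Y\<close> with respect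
  to \<open>PX\<close>.  The delicate converse starts from a density of \<open>P\<close> with respect to an arbitrary product.
  The set where it is positive is a countable union of sets of finite outer measure, so that
  it is covered, up to a null set, by countably many rectangles with sides of finite
  measure (\<open>arb_prod_support\<close>).  This brings everything back to a product of \<open>\<sigma>\<close>-finite measures, on
  which the marginals have densities that can be compared directly (\<open>abs_cont_marginals\<close>).

  The main point is that \<open>P \<lless> PX \<Otimes> PY\<close> implies (b), where \<open>\<nu>\<close> may be far from \<open>\<sigma>\<close>-finite.  For almost
  every \<open>x\<close> the set \<open>U x = {y. p(y|x) > 0}\<close> is \<open>\<sigma>\<close>-finite for \<open>\<nu>\<close>, but the union of all these
  sets need not be.  An exhaustion argument (\<open>countable_essential_union\<close>) chooses countably many
  of them, with union \<open>V\<close>, such that every \<open>U x - V\<close> is \<open>PY\<close>-null.  Then \<open>{(x, y). y \<in> U x - V}\<close>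
  is null for \<open>PX \<Otimes> PY\<close> and hence for \<open>P\<close>; as \<open>P\<close> is carried by \<open>{(x, y). y \<in> U x}\<close>, almost surely
  \<open>Y \<in> V\<close>, and \<open>\<nu>\<close> can be replaced by its restriction to \<open>V\<close> (\<open>abs_cont_imp_localizes\<close>).

  Once \<open>\<nu>\<close> is \<open>\<sigma>\<close>-finite, Fubini's theorem makes \<open>p(y|x)\<close> a joint density with respect to
  \<open>PX \<Otimes> \<nu>\<close>, which returns to (a), and Bayes' formula is the disintegration of this density over \<open>y\<close>
  (\<open>bayes_cond_density\<close>).  Formula (c') is (c) with \<open>PX\<close> replaced by \<open>p(x) \<mu>(dx)\<close>, and for \<open>\<mu> = PX\<close> it
  provides the \<open>\<sigma>\<close>-finite conditional density demanded in (a).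
\<close>

section \<open>Measures restricted to \<open>\<sigma>\<close>-finite parts\<close>

text \<open>
  The restricted measure still lives on the whole space, but the complement of \<open>\<Union>F\<close> has become a
  null set and can be added to the covering family.
\<close>

lemma sigma_finite_restricted_Union:
  assumes "countable F" "F \<subseteq> sets \<mu>" "\<And>A. A \<in> F \<Longrightarrow> emeasure \<mu> A < \<infinity>"
  shows "sigma_finite_measure (density \<mu> (indicator (\<Union>F)))"
proof
  have U: "\<Union>F \<in> sets \<mu>"
    using assms by (intro sets.countable_Union) auto
  let ?F = "insert (space \<mu> - \<Union>F) F"
  have "emeasure (density \<mu> (indicator (\<Union>F))) A \<noteq> \<infinity>" if "A \<in> ?F" for A
  proof (cases "A \<in> F")
    case True
    then have "emeasure (density \<mu> (indicator (\<Union>F))) A = emeasure \<mu> A"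
      using U assms by (subst emeasure_restricted) (auto intro!: arg_cong[where f = "emeasure \<mu>"])
    then show ?thesis using assms(3)[OF True] by simp
  next
    case False
    then have "A = space \<mu> - \<Union>F" using that by auto
    then show ?thesis using U by (subst emeasure_restricted) auto
  qed
  then show "\<exists>A. countable A \<and> A \<subseteq> sets (density \<mu> (indicator (\<Union>F))) \<and>
      \<Union>A = space (density \<mu> (indicator (\<Union>F))) \<and>
      (\<forall>a\<in>A. emeasure (density \<mu> (indicator (\<Union>F))) a \<noteq> \<infinity>)"
    using assms U sets.sets_into_space[of _ \<mu>] by (intro exI[of _ ?F]) (auto, blast)
qed

text \<open>
  The set \<open>f \<ge> 1/n\<close>, empty for \<open>n = 0\<close>.  The product form is the one in Markov's inequality and also
  covers the value \<open>\<infinity>\<close>.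
\<close>

definition superlevel :: "'a measure \<Rightarrow> ('a \<Rightarrow> ennreal) \<Rightarrow> nat \<Rightarrow> 'a set" where
  "superlevel \<mu> f n = {x \<in> space \<mu>. 1 \<le> of_nat n * f x}"

lemma superlevel_sets: "f \<in> borel_measurable \<mu> \<Longrightarrow> superlevel \<mu> f n \<in> sets \<mu>"
  unfolding superlevel_def by measurable

lemma superlevel_finite:
  assumes "f \<in> borel_measurable \<mu>" "integral\<^sup>N \<mu> f < \<infinity>"
  shows "emeasure \<mu> (superlevel \<mu> f n) < \<infinity>"
proof -
  have "emeasure \<mu> (superlevel \<mu> f n) \<le> of_nat n * (\<integral>\<^sup>+x. f x * indicator (space \<mu>) x \<partial>\<mu>)"
    unfolding superlevel_def using assms by (intro nn_integral_Markov_inequality) auto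
  also have "\<dots> = of_nat n * integral\<^sup>N \<mu> f"
    by (intro arg_cong2[where f = "(*)"] nn_integral_cong) auto
  also have "\<dots> < \<infinity>"
    using assms by (simp add: ennreal_mult_less_top of_nat_less_top)
  finally show ?thesis .
qed

lemma UN_superlevel: "(\<Union>n. superlevel \<mu> f n) = {x \<in> space \<mu>. f x > 0}"
proof -
  have "\<exists>n. 1 \<le> of_nat n * f x" if pos: "f x > 0" for x
  proof (cases "f x = \<infinity>")
    case True
    then show ?thesis by (intro exI[of _ 1]) simp
  next
    case False
    then obtain r where r: "f x = ennreal r" "0 < r"
      using pos by (cases "f x") (auto simp: ennreal_less_zero_iff)
    obtain n where "1 / r \<le> real n" using real_arch_simple by blast
    then have "1 \<le> real n * r" using r by (simp add: field_simps)
    then have "1 \<le> of_nat n * f x"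
      using r by (simp add: ennreal_of_nat_eq_real_of_nat flip: ennreal_mult)
    then show ?thesis ..
  qed
  moreover have "f x > 0" if "1 \<le> of_nat n * f x" for x n
    using that by (cases "f x = 0") (auto simp: zero_less_iff_neq_zero)
  ultimately show ?thesis
    by (auto simp: superlevel_def)
qed

text \<open>
  A countable subfamily whose union has the largest possible measure must swallow every other
  member of the family up to a null set: adding that member cannot increase the measure.  This
  replaces an uncountable union, which may be far too large or not measurable.
\<close>

lemma (in finite_measure) countable_essential_union:
  assumes sets: "\<V> \<subseteq> sets M"
  obtains C where "countable C" "C \<subseteq> \<V>" "\<And>W. W \<in> \<V> \<Longrightarrow> W - \<Union>C \<in> null_sets M"
proof -
  let ?I = "{C. countable C \<and> C \<subseteq> \<V>}" and ?m = "\<lambda>C. emeasure M (\<Union>C)"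
  have "?I \<noteq> {}" by auto
  from ennreal_SUP_countable_SUP[OF this, of ?m] obtain f :: "nat \<Rightarrow> ennreal"
    where f: "range f \<subseteq> ?m ` ?I" "(SUP C\<in>?I. ?m C) = (SUP n. f n)" by auto
  have "\<exists>D. D \<in> ?I \<and> f n = ?m D" for n using f(1) by blast
  then obtain D where D: "\<And>n. D n \<in> ?I" "\<And>n. f n = ?m (D n)" by metis
  let ?C = "\<Union>n. D n"
  have C: "?C \<in> ?I" using D(1) by auto
  have meas: "\<Union>E \<in> sets M" if "E \<in> ?I" for E
    using that sets by (intro sets.countable_Union) auto
  have max: "?m E \<le> ?m ?C" if "E \<in> ?I" for E
  proof -
    have "?m E \<le> (SUP C\<in>?I. ?m C)" using that by (rule SUP_upper)
    also have "\<dots> = (SUP n. ?m (D n))" using f(2) D(2) by simp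
    also have "\<dots> \<le> ?m ?C"
      using meas[OF C] by (intro SUP_least emeasure_mono) auto
    finally show ?thesis .
  qed
  have "W - \<Union>?C \<in> null_sets M" if W: "W \<in> \<V>" for W
  proof (rule null_setsI)
    show s: "W - \<Union>?C \<in> sets M" using W sets meas[OF C] by auto
    have eq: "\<Union>(insert W ?C) = \<Union>?C \<union> (W - \<Union>?C)" by auto
    have "?m ?C + emeasure M (W - \<Union>?C) = ?m (insert W ?C)"
      unfolding eq using s meas[OF C] by (intro plus_emeasure) auto
    also have "\<dots> \<le> ?m ?C"
      using C W by (intro max) auto
    finally show "emeasure M (W - \<Union>?C) = 0"
      using ennreal_add_left_cancel_le[of "?m ?C" "emeasure M (W - \<Union>?C)" 0]
      by (simp add: emeasure_finite)
  qed
  with C show thesis by (intro that[of ?C]) auto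
qed


section \<open>The product of arbitrary measures\<close>

text \<open>
  For \<open>\<sigma>\<close>-finite factors a product is determined by its values on rectangles, and countable
  subadditivity of the iterated integral shows that no cover of a rectangle is cheaper than the
  rectangle itself.
\<close>

lemma arb_prod_eq_pair_measure:
  assumes "sigma_finite_measure \<mu>" "sigma_finite_measure \<nu>"
  shows "arb_prod \<mu> \<nu> = \<mu> \<Otimes>\<^sub>M \<nu>"
proof -
  interpret \<nu>: sigma_finite_measure \<nu> by fact
  have "emeasure \<mu> A * emeasure \<nu> B = emeasure (arb_prod \<mu> \<nu>) (A \<times> B)"
    if A: "A \<in> sets \<mu>" and B: "B \<in> sets \<nu>" for A B
  proof (rule antisym)
    have AB: "A \<times> B \<in> sets (\<mu> \<Otimes>\<^sub>M \<nu>)" using A B by auto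
    have "emeasure (\<mu> \<Otimes>\<^sub>M \<nu>) (A \<times> B) \<le> rect_outer \<mu> \<nu> (A \<times> B)"
      unfolding rect_outer_def
    proof (rule INF_greatest, clarify)
      fix A' B' assume "(A', B') \<in> rect_cover \<mu> \<nu> (A \<times> B)"
      then have *: "\<And>k. A' k \<in> sets \<mu>" "\<And>k. B' k \<in> sets \<nu>" "A \<times> B \<subseteq> (\<Union>k. A' k \<times> B' k)"
        by (auto simp: rect_cover_def)
      have "emeasure (\<mu> \<Otimes>\<^sub>M \<nu>) (A \<times> B) \<le> emeasure (\<mu> \<Otimes>\<^sub>M \<nu>) (\<Union>k. A' k \<times> B' k)"
        using * by (intro emeasure_mono) auto
      also have "\<dots> \<le> (\<Sum>k. emeasure (\<mu> \<Otimes>\<^sub>M \<nu>) (A' k \<times> B' k))"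
        using * by (intro emeasure_subadditive_countably) auto
      finally show "emeasure (\<mu> \<Otimes>\<^sub>M \<nu>) (A \<times> B) \<le> (\<Sum>k. emeasure \<mu> (A' k) * emeasure \<nu> (B' k))"
        using * by (simp add: \<nu>.emeasure_pair_measure_Times)
    qed
    then show "emeasure \<mu> A * emeasure \<nu> B \<le> emeasure (arb_prod \<mu> \<nu>) (A \<times> B)"
      using A B AB by (simp add: emeasure_arb_prod \<nu>.emeasure_pair_measure_Times)
    have "rect_outer \<mu> \<nu> (A \<times> B) \<le>
        (\<Sum>k::nat. emeasure \<mu> (if k = 0 then A else {}) * emeasure \<nu> B)"
      using A B by (intro rect_outer_le) (auto split: if_splits)
    also have "\<dots> = emeasure \<mu> A * emeasure \<nu> B"
      by (subst suminf_finite[of "{0}"]) auto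
    finally show "emeasure (arb_prod \<mu> \<nu>) (A \<times> B) \<le> emeasure \<mu> A * emeasure \<nu> B"
      using AB by (simp add: emeasure_arb_prod)
  qed
  then show ?thesis
    using assms by (intro pair_measure_eqI[symmetric]) (auto simp: sets_arb_prod)
qed

text \<open>
  Intersecting a cover of \<open>S\<close> with \<open>A \<times> B\<close> leaves a cover of \<open>S\<close>, and the measures of the smaller
  sides are the restricted measures of the original ones.
\<close>

lemma rect_outer_le_restricted:
  assumes A: "A \<in> sets \<mu>" and B: "B \<in> sets \<nu>" and S: "S \<subseteq> A \<times> B"
  shows "rect_outer \<mu> \<nu> S \<le> rect_outer (density \<mu> (indicator A)) (density \<nu> (indicator B)) S"
  unfolding rect_outer_def[of "density \<mu> (indicator A)"]
proof (rule INF_greatest, clarify)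
  let ?\<mu> = "density \<mu> (indicator A)" and ?\<nu> = "density \<nu> (indicator B)"
  fix A' B' assume "(A', B') \<in> rect_cover ?\<mu> ?\<nu> S"
  then have *: "\<And>k. A' k \<in> sets \<mu>" "\<And>k. B' k \<in> sets \<nu>" "S \<subseteq> (\<Union>k. A' k \<times> B' k)"
    by (auto simp: rect_cover_def)
  have "rect_outer \<mu> \<nu> S \<le> (\<Sum>k. emeasure \<mu> (A \<inter> A' k) * emeasure \<nu> (B \<inter> B' k))"
    by (rule rect_outer_le) (use * A B in blast, use * A B in blast, use * S in blast)
  then show "rect_outer \<mu> \<nu> S \<le> (\<Sum>k. emeasure ?\<mu> (A' k) * emeasure ?\<nu> (B' k))"
    using * A B by (simp add: emeasure_restricted)
qed

text \<open>
  A set where an integrable function is positive is a countable union of sets of finite measure,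
  and each of these is covered by countably many rectangles \<open>A \<times> B\<close> with \<open>\<mu> A * \<nu> B\<close> finite.  If one
  factor is infinite, the other is zero, so that the rectangle is null; the remaining
  rectangles have two finite sides.
\<close>

lemma arb_prod_support:
  assumes f: "f \<in> borel_measurable (arb_prod \<mu> \<nu>)"
    and fin: "integral\<^sup>N (arb_prod \<mu> \<nu>) f < \<infinity>"
  obtains A B where "A \<in> sets \<mu>" "B \<in> sets \<nu>"
    "sigma_finite_measure (density \<mu> (indicator A))"
    "sigma_finite_measure (density \<nu> (indicator B))"
    "AE z in arb_prod \<mu> \<nu>. f z > 0 \<longrightarrow> z \<in> A \<times> B"
proof -
  let ?N = "arb_prod \<mu> \<nu>"
  let ?L = "superlevel ?N f"
  have L: "?L n \<in> sets (\<mu> \<Otimes>\<^sub>M \<nu>)" for n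
    using superlevel_sets[OF f] by (simp add: sets_arb_prod)
  have "rect_outer \<mu> \<nu> (?L n) < \<infinity>" for n
    using superlevel_finite[OF f fin, of n] L by (simp add: emeasure_arb_prod)
  then have "\<exists>P. range (fst P) \<subseteq> sets \<mu> \<and> range (snd P) \<subseteq> sets \<nu> \<and>
      ?L n \<subseteq> (\<Union>k. fst P k \<times> snd P k) \<and>
      (\<Sum>k. emeasure \<mu> (fst P k) * emeasure \<nu> (snd P k)) < \<infinity>" (is "\<exists>P. ?Q n P") for n
    using rect_outer_close[of \<mu> \<nu> "?L n" \<infinity>] by simp
  then have "\<forall>n. \<exists>P. ?Q n P" ..
  from choice[OF this] obtain P where P: "\<forall>n. ?Q n (P n)" ..
  define A B where "A n = fst (P n)" and "B n = snd (P n)" for n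
  note Q = P[rule_format, folded A_def B_def]
  have A: "A n k \<in> sets \<mu>" and B: "B n k \<in> sets \<nu>"
    and cov: "?L n \<subseteq> (\<Union>k. A n k \<times> B n k)"
    and sum: "(\<Sum>k. emeasure \<mu> (A n k) * emeasure \<nu> (B n k)) < \<infinity>" for n k
    using Q[of n] by blast+
  have prod: "emeasure \<mu> (A n k) * emeasure \<nu> (B n k) < \<infinity>" for n k
    using ennreal_suminf_lessD[of _ top, OF sum[of n, simplified infinity_ennreal_def], of k] by simp
  define G where "G = {(n, k). emeasure \<mu> (A n k) < \<infinity> \<and> emeasure \<nu> (B n k) < \<infinity>}"
  let ?FA = "(\<lambda>(n, k). A n k) ` G" and ?FB = "(\<lambda>(n, k). B n k) ` G"
  have cnt: "countable ?FA" "countable ?FB" by auto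
  have sub: "?FA \<subseteq> sets \<mu>" "?FB \<subseteq> sets \<nu>" using A B by auto
  have null: "A n k \<times> B n k \<in> null_sets ?N" if "(n, k) \<notin> G" for n k
  proof (rule null_setsI)
    show s: "A n k \<times> B n k \<in> sets ?N" using A B by (simp add: sets_arb_prod)
    have 0: "emeasure \<mu> (A n k) * emeasure \<nu> (B n k) = 0"
      using that prod[of n k] unfolding G_def
      by (auto simp: not_less top_unique ennreal_mult_less_top ennreal_mult_eq_top_iff less_top[symmetric])
    have "rect_outer \<mu> \<nu> (A n k \<times> B n k) \<le> (\<Sum>j::nat. emeasure \<mu> (A n k) * emeasure \<nu> (B n k))"
      using A B by (intro rect_outer_le) auto
    then show "emeasure ?N (A n k \<times> B n k) = 0"
      using s by (simp add: emeasure_arb_prod sets_arb_prod 0)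
  qed
  have "AE z in ?N. (n, k) \<notin> G \<longrightarrow> z \<notin> A n k \<times> B n k" for n k
    using AE_not_in[OF null[of n k]] by (cases "(n, k) \<in> G") auto
  then have "AE z in ?N. \<forall>n k. (n, k) \<notin> G \<longrightarrow> z \<notin> A n k \<times> B n k"
    by (simp only: AE_all_countable) blast
  then have AE: "AE z in ?N. f z > 0 \<longrightarrow> z \<in> \<Union>?FA \<times> \<Union>?FB"
  proof (rule AE_mp, intro AE_I2 impI)
    fix z assume z: "z \<in> space ?N" "\<forall>n k. (n, k) \<notin> G \<longrightarrow> z \<notin> A n k \<times> B n k" "f z > 0"
    then have "z \<in> (\<Union>n. ?L n)" unfolding UN_superlevel by simp
    then obtain n k where "z \<in> A n k \<times> B n k" using cov by blast
    with z(2) show "z \<in> \<Union>?FA \<times> \<Union>?FB" by (cases z) blast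
  qed
  have fin: "\<And>a. a \<in> ?FA \<Longrightarrow> emeasure \<mu> a < \<infinity>" "\<And>b. b \<in> ?FB \<Longrightarrow> emeasure \<nu> b < \<infinity>"
    by (auto simp: G_def)
  show thesis
  proof (rule that[OF _ _ _ _ AE])
    show "\<Union>?FA \<in> sets \<mu>" "\<Union>?FB \<in> sets \<nu>"
      by (rule sets.countable_Union[OF cnt(1) sub(1)] sets.countable_Union[OF cnt(2) sub(2)])+
    show "sigma_finite_measure (density \<mu> (indicator (\<Union>?FA)))"
      by (rule sigma_finite_restricted_Union[OF cnt(1) sub(1) fin(1)])
    show "sigma_finite_measure (density \<nu> (indicator (\<Union>?FB)))"
      by (rule sigma_finite_restricted_Union[OF cnt(2) sub(2) fin(2)])
  qed
qed


section \<open>Conditional densities as iterated integrals\<close>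

lemma indicator_section: "indicator {x. (x, y) \<in> S} x = indicator S (x, y)"
  by (simp add: indicator_def)

text \<open>
  A conditional density determines its kernel for every parameter in the space, so the kernel can
  be eliminated.  What remains of it is the measurability of the partial integrals, which
  need not follow from joint measurability when \<open>\<mu>\<close> is not \<open>\<sigma>\<close>-finite.
\<close>

lemma cond_density_iff:
  assumes X: "X \<in> measurable M MX" and Y: "Y \<in> measurable M MY"
  shows "cond_density M MX MY X Y \<mu> p \<longleftrightarrow>
    sets \<mu> = sets MX \<and> (\<lambda>(x, y). p x y) \<in> borel_measurable (MX \<Otimes>\<^sub>M MY) \<and>
    (\<forall>S\<in>sets MX. (\<lambda>y. \<integral>\<^sup>+x\<in>S. p x y \<partial>\<mu>) \<in> borel_measurable MY) \<and>
    (\<forall>S\<in>sets (MX \<Otimes>\<^sub>M MY). emeasure (distr M (MX \<Otimes>\<^sub>M MY) (\<lambda>\<omega>. (X \<omega>, Y \<omega>))) S =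
        (\<integral>\<^sup>+y. (\<integral>\<^sup>+x. p x y * indicator S (x, y) \<partial>\<mu>) \<partial>distr M MY Y))"
    (is "?L \<longleftrightarrow> ?s \<and> ?m \<and> ?k \<and> ?e")
proof
  have sec: "{x. (x, y) \<in> S} \<in> sets MX" if "S \<in> sets (MX \<Otimes>\<^sub>M MY)" for S y
    using sets_Pair2[OF that, of y] by (simp add: vimage_def)
  {
    assume ?L
    then obtain \<kappa> where s: ?s and m: ?m and \<kappa>: "cond_distribution M MX MY X Y \<kappa>"
      "\<And>y S. y \<in> space MY \<Longrightarrow> S \<in> sets MX \<Longrightarrow> emeasure (\<kappa> y) S = (\<integral>\<^sup>+x\<in>S. p x y \<partial>\<mu>)"
      unfolding cond_density_def by auto
    have ?k
    proof
      fix S assume S: "S \<in> sets MX"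
      then have "(\<lambda>y. emeasure (\<kappa> y) S) \<in> borel_measurable MY"
        using \<kappa>(1) by (simp add: cond_distribution_def transition_measure_def)
      then show "(\<lambda>y. \<integral>\<^sup>+x\<in>S. p x y \<partial>\<mu>) \<in> borel_measurable MY"
        using \<kappa>(2) S by (simp cong: measurable_cong)
    qed
    moreover have ?e
      using \<kappa> by (auto simp: cond_distribution_def transition_prod_def sec indicator_section intro!: nn_integral_cong)
    ultimately show "?s \<and> ?m \<and> ?k \<and> ?e" using s m by blast
  }
  assume "?s \<and> ?m \<and> ?k \<and> ?e"
  then have s: ?s and m: ?m and k: ?k and e: ?e by blast+
  define \<kappa> where "\<kappa> y = density \<mu> (\<lambda>x. p x y)" for y
  have "(\<lambda>x. p x y) \<in> borel_measurable MX" if "y \<in> space MY" for y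
    using measurable_compose[OF measurable_Pair2'[OF that] m] by simp
  then have my: "(\<lambda>x. p x y) \<in> borel_measurable \<mu>" if "y \<in> space MY" for y
    using that by (simp add: measurable_cong_sets[OF s refl])
  have \<kappa>: "emeasure (\<kappa> y) S = (\<integral>\<^sup>+x\<in>S. p x y \<partial>\<mu>)" if "y \<in> space MY" "S \<in> sets MX" for y S
    unfolding \<kappa>_def using my that s by (simp add: emeasure_density)
  have "cond_distribution M MX MY X Y \<kappa>"
    unfolding cond_distribution_def transition_measure_def
  proof (intro conjI ballI)
    show "sets (\<kappa> y) = sets MX" for y by (simp add: \<kappa>_def s)
    show "(\<lambda>y. emeasure (\<kappa> y) S) \<in> borel_measurable MY" if "S \<in> sets MX" for S
      using k that \<kappa> by (simp cong: measurable_cong)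
    show "emeasure (distr M (MX \<Otimes>\<^sub>M MY) (\<lambda>\<omega>. (X \<omega>, Y \<omega>))) S = transition_prod \<kappa> (distr M MY Y) S"
      if "S \<in> sets (MX \<Otimes>\<^sub>M MY)" for S
      using e that by (auto simp: transition_prod_def \<kappa> sec indicator_section intro!: nn_integral_cong)
  qed
  then show ?L unfolding cond_density_def using s m \<kappa> by blast
qed

lemma sets_vimage_swap:
  fixes A :: "'a measure" and B :: "'b measure"
  assumes T: "T \<in> sets (A \<Otimes>\<^sub>M B)"
  shows "prod.swap -` T \<in> sets (B \<Otimes>\<^sub>M A)"
proof -
  have "prod.swap \<in> measurable (B \<Otimes>\<^sub>M A) (A \<Otimes>\<^sub>M B)"
    by (rule measurable_cong[THEN iffD2, OF _ measurable_pair_swap']) auto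
  moreover have "prod.swap -` T \<inter> space (B \<Otimes>\<^sub>M A) = prod.swap -` T"
    using sets.sets_into_space[OF T] by (auto simp: space_pair_measure)
  ultimately show ?thesis
    using measurable_sets[of prod.swap, OF _ T] by metis
qed

lemma cond_density_kernel_abs_cont:
  assumes "cond_density M MX MY X Y \<mu> q"
  obtains \<kappa> where "cond_distribution M MX MY X Y \<kappa>"
    "\<And>y. y \<in> space MY \<Longrightarrow> absolutely_continuous \<mu> (\<kappa> y)"
proof -
  obtain \<kappa> where s: "sets \<mu> = sets MX" and \<kappa>: "cond_distribution M MX MY X Y \<kappa>"
    "\<And>y S. y \<in> space MY \<Longrightarrow> S \<in> sets MX \<Longrightarrow> emeasure (\<kappa> y) S = (\<integral>\<^sup>+x\<in>S. q x y \<partial>\<mu>)"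
    using assms unfolding cond_density_def by auto
  have "absolutely_continuous \<mu> (\<kappa> y)" if y: "y \<in> space MY" for y
    unfolding absolutely_continuous_def
  proof
    fix S assume S: "S \<in> null_sets \<mu>"
    then have SX: "S \<in> sets MX" using s by auto
    have "emeasure (\<kappa> y) S = (\<integral>\<^sup>+x. 0 \<partial>\<mu>)"
      unfolding \<kappa>(2)[OF y SX] using AE_not_in[OF S] by (intro nn_integral_cong_AE) auto
    moreover have "sets (\<kappa> y) = sets MX"
      using \<kappa>(1) y by (simp add: cond_distribution_def transition_measure_def)
    ultimately show "S \<in> null_sets (\<kappa> y)"
      using SX by auto
  qed
  with \<kappa>(1) show thesis by (rule that)
qed


section \<open>The quotient in Bayes' formula\<close>

text \<open>
  For a fixed denominator the quotient is multiplication by a constant, with the conventions for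
  \<open>0\<close> and \<open>\<infinity>\<close> absorbed into the constant; so it commutes with integrals of the numerator.
\<close>

lemma bayes_quotient_eq_mult:
  "bayes_quotient a b = a * (if b = 0 \<or> b = \<infinity> then 0 else inverse b)"
  by (simp add: bayes_quotient_def divide_ennreal_def)

lemma nn_integral_bayes_quotient:
  assumes "f \<in> borel_measurable \<mu>"
  shows "(\<integral>\<^sup>+x. bayes_quotient (f x) b \<partial>\<mu>) = bayes_quotient (integral\<^sup>N \<mu> f) b"
  unfolding bayes_quotient_eq_mult using assms by (intro nn_integral_multc) auto

lemma borel_measurable_bayes_quotient [measurable]:
  assumes [measurable]: "f \<in> borel_measurable \<mu>" "g \<in> borel_measurable \<mu>"
  shows "(\<lambda>x. bayes_quotient (f x) (g x)) \<in> borel_measurable \<mu>"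
  unfolding bayes_quotient_def by measurable

lemma bayes_quotient_indicator:
  "bayes_quotient a b * indicator S x = bayes_quotient (a * indicator S x) b"
  by (simp add: bayes_quotient_eq_mult ac_simps)


lemma mult_bayes_quotient:
  assumes "a \<le> b" "b \<noteq> \<infinity>"
  shows "b * bayes_quotient a b = a"
proof (cases "b = 0")
  case False
  then show ?thesis
    using assms mult_divide_eq_ennreal[of b a]
    by (simp add: bayes_quotient_def ennreal_times_divide mult.commute[of b])
qed (use assms in simp)



section \<open>Joint distributions dominated by the product of the marginals\<close>

locale random_pair = prob_space M
  for M :: "'w measure" and MX :: "'x measure" and MY :: "'y measure"
    and X :: "'w \<Rightarrow> 'x" and Y :: "'w \<Rightarrow> 'y" +
  assumes X [measurable]: "X \<in> measurable M MX" and Y [measurable]: "Y \<in> measurable M MY"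
begin

abbreviation "PX \<equiv> distr M MX X"
abbreviation "PY \<equiv> distr M MY Y"
abbreviation "PXY \<equiv> distr M (MX \<Otimes>\<^sub>M MY) (\<lambda>\<omega>. (X \<omega>, Y \<omega>))"

sublocale PX: prob_space PX by (rule prob_space_distr) (rule X)
sublocale PY: prob_space PY by (rule prob_space_distr) (rule Y)
sublocale marginals: pair_sigma_finite PX PY ..

lemma sets_marginals [measurable_cong]: "sets (PX \<Otimes>\<^sub>M PY) = sets (MX \<Otimes>\<^sub>M MY)"
  by (intro sets_pair_measure_cong) auto

lemma emeasure_PXY_cylinder_X: "A \<in> sets MX \<Longrightarrow> emeasure PXY (A \<times> space MY) = emeasure PX A"
  using measurable_space[OF Y]
  by (subst (1 2) emeasure_distr) (auto intro!: arg_cong[where f = "emeasure M"])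

lemma emeasure_PXY_cylinder_Y: "B \<in> sets MY \<Longrightarrow> emeasure PXY (space MX \<times> B) = emeasure PY B"
  using measurable_space[OF X]
  by (subst (1 2) emeasure_distr) (auto intro!: arg_cong[where f = "emeasure M"])

text \<open>
  Both marginals have densities with respect to the factors of a dominating product.  Outside
  the set where these two densities are positive there is no joint mass, and on that set the
  dominating product and \<open>PX \<Otimes>\<^sub>M PY\<close> have the same null sets.
\<close>

lemma abs_cont_marginals:
  assumes \<mu>: "sigma_finite_measure \<mu>" "sets \<mu> = sets MX"
    and \<nu>: "sigma_finite_measure \<nu>" "sets \<nu> = sets MY"
    and ac: "absolutely_continuous (\<mu> \<Otimes>\<^sub>M \<nu>) PXY"
  shows "absolutely_continuous (PX \<Otimes>\<^sub>M PY) PXY"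
proof -
  interpret \<mu>: sigma_finite_measure \<mu> by fact
  interpret \<nu>: sigma_finite_measure \<nu> by fact
  have sp: "space \<mu> = space MX" "space \<nu> = space MY"
    by (rule sets_eq_imp_space_eq[OF \<mu>(2)], rule sets_eq_imp_space_eq[OF \<nu>(2)])
  have s: "sets (\<mu> \<Otimes>\<^sub>M \<nu>) = sets (MX \<Otimes>\<^sub>M MY)"
    using \<mu> \<nu> by (intro sets_pair_measure_cong)
  have top: "space MX \<in> sets \<mu>" "space MY \<in> sets \<nu>"
    using \<mu>(2) \<nu>(2) by auto
  have acX: "absolutely_continuous \<mu> PX"
    unfolding absolutely_continuous_def
  proof
    fix A assume A: "A \<in> null_sets \<mu>"
    then have A': "A \<in> sets MX" using \<mu> by auto
    have "A \<times> space MY \<in> null_sets (\<mu> \<Otimes>\<^sub>M \<nu>)"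
      using A top \<nu>.emeasure_pair_measure_Times[OF null_setsD2[OF A], of "space MY"] by (auto intro!: null_setsI)
    then have "emeasure PXY (A \<times> space MY) = 0"
      using ac unfolding absolutely_continuous_def by blast
    then show "A \<in> null_sets PX" using A' emeasure_PXY_cylinder_X[of A] by auto
  qed
  have acY: "absolutely_continuous \<nu> PY"
    unfolding absolutely_continuous_def
  proof
    fix B assume B: "B \<in> null_sets \<nu>"
    then have B': "B \<in> sets MY" using \<nu> by auto
    have "space MX \<times> B \<in> null_sets (\<mu> \<Otimes>\<^sub>M \<nu>)"
      using B top \<nu>.emeasure_pair_measure_Times[OF top(1) null_setsD2[OF B]] by (auto intro!: null_setsI)
    then have "emeasure PXY (space MX \<times> B) = 0"
      using ac unfolding absolutely_continuous_def by blast
    then show "B \<in> null_sets PY" using B' emeasure_PXY_cylinder_Y[of B] by auto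
  qed
  obtain g where g [measurable]: "g \<in> borel_measurable \<mu>" and PX: "density \<mu> g = PX"
    using \<mu>.Radon_Nikodym[OF acX] \<mu>(2) by auto
  obtain h where h [measurable]: "h \<in> borel_measurable \<nu>" and PY: "density \<nu> h = PY"
    using \<nu>.Radon_Nikodym[OF acY] \<nu>(2) by auto
  have prod: "PX \<Otimes>\<^sub>M PY = density (\<mu> \<Otimes>\<^sub>M \<nu>) (\<lambda>(x, y). g x * h y)"
    using pair_measure_density[OF g h \<nu>(1)] PY.sigma_finite_measure_axioms
    unfolding PX PY by simp
  let ?E = "{x \<in> space MX. g x = 0}" and ?F = "{y \<in> space MY. h y = 0}"
  have "?E \<in> sets \<mu>" "?F \<in> sets \<nu>"
    unfolding sp[symmetric] by measurable
  then have EF: "?E \<in> sets MX" "?F \<in> sets MY"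
    using \<mu> \<nu> by auto
  have "?E \<in> null_sets (density \<mu> g)" "?F \<in> null_sets (density \<nu> h)"
    using EF \<mu> \<nu> by (auto simp: null_sets_density_iff)
  then have E0: "?E \<times> space MY \<in> null_sets PXY" and F0: "space MX \<times> ?F \<in> null_sets PXY"
    unfolding PX PY using EF emeasure_PXY_cylinder_X[OF EF(1)] emeasure_PXY_cylinder_Y[OF EF(2)]
    by (auto intro!: null_setsI)
  show ?thesis
    unfolding absolutely_continuous_def
  proof
    fix N assume N: "N \<in> null_sets (PX \<Otimes>\<^sub>M PY)"
    then have Ns: "N \<in> sets (MX \<Otimes>\<^sub>M MY)" by (auto simp: sets_marginals)
    (* ?N is the part of N where both marginal densities are positive. *)
    let ?N = "N - ?E \<times> space MY - space MX \<times> ?F"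
    have N's: "?N \<in> sets (MX \<Otimes>\<^sub>M MY)"
      using Ns EF by (intro sets.Diff) auto
    have sub: "N \<subseteq> space MX \<times> space MY"
      using sets.sets_into_space[OF Ns] by (simp add: space_pair_measure)
    have "AE z in \<mu> \<Otimes>\<^sub>M \<nu>. z \<in> N \<longrightarrow> (case z of (x, y) \<Rightarrow> g x * h y) = 0"
      using N unfolding prod by (subst (asm) null_sets_density_iff) auto
    then have "AE z in \<mu> \<Otimes>\<^sub>M \<nu>. z \<notin> ?N"
      by eventually_elim (use sub in auto)
    then have "?N \<in> null_sets (\<mu> \<Otimes>\<^sub>M \<nu>)"
      using N's s by (subst (asm) AE_iff_null_sets[symmetric]) auto
    then have "?N \<in> null_sets PXY"
      using ac unfolding absolutely_continuous_def by blast
    then have "?N \<union> (?E \<times> space MY \<union> space MX \<times> ?F) \<in> null_sets PXY"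
      using E0 F0 by (intro null_sets.Un)
    then show "N \<in> null_sets PXY"
      by (rule null_sets_subset) (use Ns in auto)
  qed
qed

text \<open>
  The joint density is supported by a rectangle \<open>A \<times> B\<close> with \<open>\<sigma>\<close>-finite sides, so that the
  arbitrary product can be replaced by the product of the two restrictions.
\<close>

lemma joint_density_imp_abs_cont:
  assumes s: "sets \<mu> = sets MX" "sets \<nu> = sets MY"
    and d: "distributed M (arb_prod \<mu> \<nu>) (\<lambda>\<omega>. (X \<omega>, Y \<omega>)) f"
  shows "absolutely_continuous (PX \<Otimes>\<^sub>M PY) PXY"
proof -
  let ?N = "arb_prod \<mu> \<nu>"
  have sets: "sets ?N = sets (MX \<Otimes>\<^sub>M MY)" "sets (\<mu> \<Otimes>\<^sub>M \<nu>) = sets (MX \<Otimes>\<^sub>M MY)"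
    using s by (auto simp: sets_arb_prod intro!: sets_pair_measure_cong)
  have f: "f \<in> borel_measurable ?N" and dens: "density ?N f = PXY"
    using d distr_cong[OF refl sets(1), of M] unfolding distributed_def by auto
  have "integral\<^sup>N ?N f = emeasure PXY (space ?N)"
    unfolding dens[symmetric] using f by (subst emeasure_density) (auto intro!: nn_integral_cong)
  also have "\<dots> = emeasure PX (space MX)"
    using emeasure_PXY_cylinder_X[of "space MX"] sets_eq_imp_space_eq[OF sets(1)]
    by (simp add: space_pair_measure)
  finally have "integral\<^sup>N ?N f < \<infinity>"
    using PX.emeasure_space_1 by simp
  from arb_prod_support[OF f this] obtain A B where A: "A \<in> sets \<mu>" and B: "B \<in> sets \<nu>"
    and sf: "sigma_finite_measure (density \<mu> (indicator A))"
      "sigma_finite_measure (density \<nu> (indicator B))"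
    and supp: "AE z in ?N. f z > 0 \<longrightarrow> z \<in> A \<times> B" .
  let ?\<mu> = "density \<mu> (indicator A)" and ?\<nu> = "density \<nu> (indicator B)"
  have AB: "A \<times> B \<in> sets (MX \<Otimes>\<^sub>M MY)" using A B s by auto
  have s': "sets (?\<mu> \<Otimes>\<^sub>M ?\<nu>) = sets (MX \<Otimes>\<^sub>M MY)"
    using s by (intro sets_pair_measure_cong) auto
  have "absolutely_continuous (?\<mu> \<Otimes>\<^sub>M ?\<nu>) PXY"
    unfolding absolutely_continuous_def
  proof
    fix S assume S: "S \<in> null_sets (?\<mu> \<Otimes>\<^sub>M ?\<nu>)"
    then have Ss: "S \<in> sets (MX \<Otimes>\<^sub>M MY)" unfolding s'[symmetric] by (rule null_setsD2)
    let ?S = "S \<inter> A \<times> B"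
    have S's: "?S \<in> sets (MX \<Otimes>\<^sub>M MY)" using Ss AB by auto
    have "rect_outer \<mu> \<nu> ?S \<le> rect_outer ?\<mu> ?\<nu> ?S"
      using A B by (intro rect_outer_le_restricted) auto
    also have "\<dots> = emeasure (?\<mu> \<Otimes>\<^sub>M ?\<nu>) ?S"
      unfolding arb_prod_eq_pair_measure[OF sf, symmetric]
      using S's[folded s'] by (rule emeasure_arb_prod[symmetric])
    also have "\<dots> \<le> emeasure (?\<mu> \<Otimes>\<^sub>M ?\<nu>) S"
      using Ss[folded s'] by (intro emeasure_mono) blast+
    also have "\<dots> = 0" using S by auto
    finally have "?S \<in> null_sets ?N"
      using S's[folded sets(1)] S's[folded sets(2)]
      by (intro null_setsI) (simp_all add: emeasure_arb_prod)
    from AE_not_in[OF this] supp have "AE z in ?N. z \<in> S \<longrightarrow> f z = 0"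
      by eventually_elim (auto simp: zero_less_iff_neq_zero)
    then show "S \<in> null_sets PXY"
      unfolding dens[symmetric] using f Ss sets by (simp add: null_sets_density_iff)
  qed
  then show ?thesis
    using sf s by (intro abs_cont_marginals[of ?\<mu> ?\<nu>]) auto
qed

lemma abs_cont_imp_joint_density:
  assumes ac: "absolutely_continuous (PX \<Otimes>\<^sub>M PY) PXY"
  obtains f where "f \<in> borel_measurable (MX \<Otimes>\<^sub>M MY)" "density (PX \<Otimes>\<^sub>M PY) f = PXY"
proof -
  have "sets PXY = sets (PX \<Otimes>\<^sub>M PY)"
    by (simp only: sets_distr sets_marginals)
  from marginals.P.Radon_Nikodym[OF ac this] obtain f
    where "f \<in> borel_measurable (PX \<Otimes>\<^sub>M PY)" "density (PX \<Otimes>\<^sub>M PY) f = PXY" ..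
  then show thesis
    by (intro that[of f]) (simp_all only: measurable_cong_sets[OF sets_marginals refl])
qed

text \<open>
  A density with respect to \<open>PX \<Otimes>\<^sub>M PY\<close> is normalized already: integrating it over the second
  variable against \<open>PY\<close> is what the product of a kernel with \<open>PY\<close> asks for.
\<close>

lemma abs_cont_imp_cond_density:
  assumes ac: "absolutely_continuous (PX \<Otimes>\<^sub>M PY) PXY"
  obtains q where "cond_density M MX MY X Y PX q"
proof -
  obtain f where f [measurable]: "f \<in> borel_measurable (MX \<Otimes>\<^sub>M MY)"
    and dens: "density (PX \<Otimes>\<^sub>M PY) f = PXY"
    using ac by (rule abs_cont_imp_joint_density)
  have "cond_density M MX MY X Y PX (\<lambda>x y. f (x, y))"
    unfolding cond_density_iff[OF X Y]
  proof (intro conjI ballI)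
    show "(\<lambda>(x, y). f (x, y)) \<in> borel_measurable (MX \<Otimes>\<^sub>M MY)" by simp
    show "(\<lambda>y. \<integral>\<^sup>+x\<in>S. f (x, y) \<partial>PX) \<in> borel_measurable MY" if [measurable]: "S \<in> sets MX" for S
      by measurable
    fix S assume S [measurable]: "S \<in> sets (MX \<Otimes>\<^sub>M MY)"
    have "emeasure PXY S = (\<integral>\<^sup>+z. f z * indicator S z \<partial>(PX \<Otimes>\<^sub>M PY))"
      unfolding dens[symmetric] by (subst emeasure_density) auto
    also have "\<dots> = (\<integral>\<^sup>+y. \<integral>\<^sup>+x. f (x, y) * indicator S (x, y) \<partial>PX \<partial>PY)"
      by (subst marginals.nn_integral_snd[symmetric]) auto
    finally show "emeasure PXY S = (\<integral>\<^sup>+y. \<integral>\<^sup>+x. f (x, y) * indicator S (x, y) \<partial>PX \<partial>PY)" .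
  qed simp
  then show thesis by (rule that)
qed

lemma sigma_finite_cond_density_imp_joint_density:
  assumes \<mu>: "sigma_finite_measure \<mu>" and q: "cond_density M MX MY X Y \<mu> q"
  shows "distributed M (arb_prod \<mu> PY) (\<lambda>\<omega>. (X \<omega>, Y \<omega>)) (\<lambda>(x, y). q x y)"
proof -
  interpret \<mu>: sigma_finite_measure \<mu> by fact
  interpret P: pair_sigma_finite \<mu> PY ..
  from q have s [measurable_cong]: "sets \<mu> = sets MX"
    and m [measurable]: "(\<lambda>(x, y). q x y) \<in> borel_measurable (MX \<Otimes>\<^sub>M MY)"
    and e: "\<And>S. S \<in> sets (MX \<Otimes>\<^sub>M MY) \<Longrightarrow>
      emeasure PXY S = (\<integral>\<^sup>+y. \<integral>\<^sup>+x. q x y * indicator S (x, y) \<partial>\<mu> \<partial>PY)"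
    unfolding cond_density_iff[OF X Y] by auto
  have sets [measurable_cong]: "sets (\<mu> \<Otimes>\<^sub>M PY) = sets (MX \<Otimes>\<^sub>M MY)"
    using s by (intro sets_pair_measure_cong) auto
  have "PXY = density (\<mu> \<Otimes>\<^sub>M PY) (\<lambda>(x, y). q x y)"
  proof (rule measure_eqI)
    fix S assume "S \<in> sets PXY"
    then have S [measurable]: "S \<in> sets (MX \<Otimes>\<^sub>M MY)" by simp
    have "emeasure PXY S = (\<integral>\<^sup>+z. (case z of (x, y) \<Rightarrow> q x y) * indicator S z \<partial>(\<mu> \<Otimes>\<^sub>M PY))"
      unfolding e[OF S] by (subst P.nn_integral_snd[symmetric]) auto
    then show "emeasure PXY S = emeasure (density (\<mu> \<Otimes>\<^sub>M PY) (\<lambda>(x, y). q x y)) S"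
      by (subst emeasure_density) auto
  qed (simp only: sets sets_distr sets_density)
  moreover have "distr M (\<mu> \<Otimes>\<^sub>M PY) (\<lambda>\<omega>. (X \<omega>, Y \<omega>)) = PXY"
    by (rule distr_cong[OF refl sets refl])
  moreover have "arb_prod \<mu> PY = \<mu> \<Otimes>\<^sub>M PY"
    by (intro arb_prod_eq_pair_measure \<mu> PY.sigma_finite_measure_axioms)
  ultimately show ?thesis
    unfolding distributed_def by simp
qed

text \<open>
  If \<open>N\<close> is null for \<open>PX \<Otimes>\<^sub>M PY\<close>, then almost all of its sections are null for \<open>PX\<close>, but not
  necessarily for \<open>\<mu>\<close>.  Their parts where the density \<open>f\<close> is positive are \<open>\<mu>\<close>-null; the
  remaining part of \<open>N\<close> lies over the \<open>PX\<close>-null set where \<open>f\<close> vanishes.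
\<close>

lemma dominated_kernel_imp_abs_cont:
  assumes \<kappa>: "cond_distribution M MX MY X Y \<kappa>"
    and s: "sets \<mu> = sets MX" and d: "distributed M \<mu> X f"
    and ac: "\<And>y. y \<in> space MY \<Longrightarrow> absolutely_continuous \<mu> (\<kappa> y)"
  shows "absolutely_continuous (PX \<Otimes>\<^sub>M PY) PXY"
  unfolding absolutely_continuous_def
proof
  have f [measurable]: "f \<in> borel_measurable \<mu>" and PX: "density \<mu> f = PX"
    using d distr_cong[OF refl s, of M X X] unfolding distributed_def by auto
  have sp: "space \<mu> = space MX" using s by (rule sets_eq_imp_space_eq)
  let ?E = "{x \<in> space MX. f x = 0}"
  have "?E \<in> sets \<mu>" unfolding sp[symmetric] by measurable
  then have E: "?E \<in> sets MX" using s by simp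
  have "?E \<in> null_sets (density \<mu> f)"
    using E s by (auto simp: null_sets_density_iff)
  then have E0: "?E \<times> space MY \<in> null_sets PXY"
    unfolding PX using E emeasure_PXY_cylinder_X[OF E] by (auto intro!: null_setsI)
  fix N assume N: "N \<in> null_sets (PX \<Otimes>\<^sub>M PY)"
  then have Ns: "N \<in> sets (MX \<Otimes>\<^sub>M MY)" by (auto simp: sets_marginals)
  let ?N = "N - ?E \<times> space MY"
  have N's: "?N \<in> sets (MX \<Otimes>\<^sub>M MY)" using Ns E by auto
  have "(\<integral>\<^sup>+y. emeasure PX ((\<lambda>x. (x, y)) -` N) \<partial>PY) = 0"
    using N marginals.emeasure_pair_measure_alt2[OF null_setsD2[OF N]] by auto
  then have "AE y in PY. emeasure PX ((\<lambda>x. (x, y)) -` N) = 0"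
    using marginals.measurable_emeasure_Pair2[OF null_setsD2[OF N]]
    by (simp only: nn_integral_0_iff_AE)
  then have "AE y in PY. emeasure (\<kappa> y) {x. (x, y) \<in> ?N} = 0"
  proof (rule AE_mp, intro AE_I2 impI)
    fix y assume "y \<in> space PY" and 0: "emeasure PX ((\<lambda>x. (x, y)) -` N) = 0"
    then have y: "y \<in> space MY" by simp
    have "(\<lambda>x. (x, y)) -` N \<in> null_sets (density \<mu> f)"
      unfolding PX using 0 sets_Pair2[OF Ns, of y] by auto
    then have "AE x in \<mu>. x \<in> (\<lambda>x. (x, y)) -` N \<longrightarrow> f x = 0"
      by (simp add: null_sets_density_iff)
    then have "AE x in \<mu>. x \<notin> {x. (x, y) \<in> ?N}"
      by (rule AE_mp) (use y sp in \<open>auto intro!: AE_I2\<close>)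
    moreover have "{x. (x, y) \<in> ?N} \<in> sets \<mu>"
      using sets_Pair2[OF N's, of y] s by (simp add: vimage_def)
    ultimately have "{x. (x, y) \<in> ?N} \<in> null_sets \<mu>"
      by (simp only: AE_iff_null_sets)
    then show "emeasure (\<kappa> y) {x. (x, y) \<in> ?N} = 0"
      using ac[OF y] unfolding absolutely_continuous_def by blast
  qed
  then have "transition_prod \<kappa> PY ?N = (\<integral>\<^sup>+y. 0 \<partial>PY)"
    unfolding transition_prod_def by (rule nn_integral_cong_AE)
  then have "?N \<in> null_sets PXY"
    using \<kappa> N's unfolding cond_distribution_def by auto
  then have "?N \<union> ?E \<times> space MY \<in> null_sets PXY"
    using E0 by (rule null_sets.Un)
  then show "N \<in> null_sets PXY"
    by (rule null_sets_subset) (use Ns in auto)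
qed


section \<open>Localizing a conditional density and Bayes' formula\<close>

text \<open>
  With the roles of the variables exchanged, the conditional density refers to the distribution of
  \<open>(Y, X)\<close>; reversing pairs expresses it by the distribution of \<open>(X, Y)\<close>, the only one used below.
\<close>

lemma cond_density_given_X_iff:
  "cond_density M MY MX Y X \<nu> p \<longleftrightarrow>
    sets \<nu> = sets MY \<and> (\<lambda>(y, x). p y x) \<in> borel_measurable (MY \<Otimes>\<^sub>M MX) \<and>
    (\<forall>B\<in>sets MY. (\<lambda>x. \<integral>\<^sup>+y\<in>B. p y x \<partial>\<nu>) \<in> borel_measurable MX) \<and>
    (\<forall>S\<in>sets (MX \<Otimes>\<^sub>M MY). emeasure PXY S =
        (\<integral>\<^sup>+x. (\<integral>\<^sup>+y. p y x * indicator S (x, y) \<partial>\<nu>) \<partial>PX))"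
proof -
  let ?PYX = "distr M (MY \<Otimes>\<^sub>M MX) (\<lambda>\<omega>. (Y \<omega>, X \<omega>))"
  let ?R = "\<lambda>S. \<integral>\<^sup>+x. \<integral>\<^sup>+y. p y x * indicator S (x, y) \<partial>\<nu> \<partial>PX"
  let ?L = "\<lambda>T. \<integral>\<^sup>+x. \<integral>\<^sup>+y. p y x * indicator T (y, x) \<partial>\<nu> \<partial>PX"
  have swap: "emeasure ?PYX T = emeasure PXY (prod.swap -` T)" "?L T = ?R (prod.swap -` T)"
    if T: "T \<in> sets (MY \<Otimes>\<^sub>M MX)" for T
    using T sets_vimage_swap[OF T] by (simp_all add: emeasure_distr vimage_def indicator_def)
  have inv: "prod.swap -` prod.swap -` S = S" for S :: "('x \<times> 'y) set"
    by auto
  have "(\<forall>T\<in>sets (MY \<Otimes>\<^sub>M MX). emeasure ?PYX T = ?L T) \<longleftrightarrow>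
      (\<forall>S\<in>sets (MX \<Otimes>\<^sub>M MY). emeasure PXY S = ?R S)"
  proof (intro iffI ballI)
    fix T assume "\<forall>S\<in>sets (MX \<Otimes>\<^sub>M MY). emeasure PXY S = ?R S" and T: "T \<in> sets (MY \<Otimes>\<^sub>M MX)"
    then show "emeasure ?PYX T = ?L T"
      unfolding swap[OF T] using sets_vimage_swap[OF T] by blast
  next
    fix S assume *: "\<forall>T\<in>sets (MY \<Otimes>\<^sub>M MX). emeasure ?PYX T = ?L T" and S: "S \<in> sets (MX \<Otimes>\<^sub>M MY)"
    have "emeasure ?PYX (prod.swap -` S) = ?L (prod.swap -` S)"
      using * sets_vimage_swap[OF S] by blast
    then show "emeasure PXY S = ?R S"
      unfolding swap[OF sets_vimage_swap[OF S]] inv .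
  qed
  then show ?thesis
    unfolding cond_density_iff[OF Y X] by blast
qed

lemma cond_density_given_X_Fubini:
  assumes \<nu>: "sigma_finite_measure \<nu>" and p: "cond_density M MY MX Y X \<nu> p"
    and S: "S \<in> sets (MX \<Otimes>\<^sub>M MY)"
  shows "emeasure PXY S = (\<integral>\<^sup>+y. \<integral>\<^sup>+x. p y x * indicator S (x, y) \<partial>PX \<partial>\<nu>)"
proof -
  interpret \<nu>: sigma_finite_measure \<nu> by fact
  interpret P: pair_sigma_finite PX \<nu> ..
  note [measurable] = S
  from p have s [measurable_cong]: "sets \<nu> = sets MY"
    and m [measurable]: "(\<lambda>(y, x). p y x) \<in> borel_measurable (MY \<Otimes>\<^sub>M MX)"
    and e: "emeasure PXY S = (\<integral>\<^sup>+x. \<integral>\<^sup>+y. p y x * indicator S (x, y) \<partial>\<nu> \<partial>PX)"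
    using S unfolding cond_density_given_X_iff by auto
  show ?thesis
    unfolding e by (rule P.Fubini'[symmetric]) measurable
qed

lemma sigma_finite_cond_density_given_X_imp_joint_density:
  assumes \<nu>: "sigma_finite_measure \<nu>" and p: "cond_density M MY MX Y X \<nu> p"
  shows "distributed M (arb_prod PX \<nu>) (\<lambda>\<omega>. (X \<omega>, Y \<omega>)) (\<lambda>(x, y). p y x)"
proof -
  interpret \<nu>: sigma_finite_measure \<nu> by fact
  from p have s [measurable_cong]: "sets \<nu> = sets MY"
    and m [measurable]: "(\<lambda>(y, x). p y x) \<in> borel_measurable (MY \<Otimes>\<^sub>M MX)"
    and e: "\<And>S. S \<in> sets (MX \<Otimes>\<^sub>M MY) \<Longrightarrow>
      emeasure PXY S = (\<integral>\<^sup>+x. \<integral>\<^sup>+y. p y x * indicator S (x, y) \<partial>\<nu> \<partial>PX)"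
    unfolding cond_density_given_X_iff by auto
  have sets: "sets (PX \<Otimes>\<^sub>M \<nu>) = sets (MX \<Otimes>\<^sub>M MY)"
    using s by (intro sets_pair_measure_cong) auto
  have "PXY = density (PX \<Otimes>\<^sub>M \<nu>) (\<lambda>(x, y). p y x)"
  proof (rule measure_eqI)
    fix S assume "S \<in> sets PXY"
    then have S [measurable]: "S \<in> sets (MX \<Otimes>\<^sub>M MY)" by simp
    have "emeasure PXY S = (\<integral>\<^sup>+z. (case z of (x, y) \<Rightarrow> p y x) * indicator S z \<partial>(PX \<Otimes>\<^sub>M \<nu>))"
      unfolding e[OF S] by (subst \<nu>.nn_integral_fst[symmetric]) auto
    then show "emeasure PXY S = emeasure (density (PX \<Otimes>\<^sub>M \<nu>) (\<lambda>(x, y). p y x)) S"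
      by (subst emeasure_density) auto
  qed (simp only: sets sets_distr sets_density)
  moreover have "distr M (PX \<Otimes>\<^sub>M \<nu>) (\<lambda>\<omega>. (X \<omega>, Y \<omega>)) = PXY"
    by (rule distr_cong[OF refl sets refl])
  moreover have "arb_prod PX \<nu> = PX \<Otimes>\<^sub>M \<nu>"
    by (intro arb_prod_eq_pair_measure \<nu> PX.sigma_finite_measure_axioms)
  ultimately show ?thesis
    unfolding distributed_def by simp
qed

text \<open>
  For almost every \<open>x\<close> the set \<open>U x\<close> where \<open>p(\<cdot>|x)\<close> is positive has \<open>\<sigma>\<close>-finite \<open>\<nu>\<close>-measure.
  Let \<open>V\<close> be the union of countably many of these sets that absorbs every other one up to a
  \<open>PY\<close>-null set.  Then \<open>{(x, y). y \<in> U x - V}\<close> is null for \<open>PX \<Otimes>\<^sub>M PY\<close>, hence for the joint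
  distribution; since the joint distribution lives on \<open>{(x, y). y \<in> U x}\<close>, \<open>Y\<close> is almost surely
  in \<open>V\<close>, and nothing is lost by restricting \<open>\<nu>\<close> to \<open>V\<close>.
\<close>

lemma abs_cont_imp_localizes:
  assumes p: "cond_density M MY MX Y X \<nu> p"
    and ac: "absolutely_continuous (PX \<Otimes>\<^sub>M PY) PXY"
  obtains V where "localizes_density M MX MY X Y \<nu> p V"
proof -
  from p have s [measurable_cong]: "sets \<nu> = sets MY"
    and m [measurable]: "(\<lambda>(y, x). p y x) \<in> borel_measurable (MY \<Otimes>\<^sub>M MX)"
    and k: "\<And>B. B \<in> sets MY \<Longrightarrow> (\<lambda>x. \<integral>\<^sup>+y\<in>B. p y x \<partial>\<nu>) \<in> borel_measurable MX"
    and e: "\<And>S. S \<in> sets (MX \<Otimes>\<^sub>M MY) \<Longrightarrow>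
      emeasure PXY S = (\<integral>\<^sup>+x. \<integral>\<^sup>+y. p y x * indicator S (x, y) \<partial>\<nu> \<partial>PX)"
    unfolding cond_density_given_X_iff by auto
  have sp: "space \<nu> = space MY" using s by (rule sets_eq_imp_space_eq)
  define G where "G = {x \<in> space MX. (\<integral>\<^sup>+y\<in>space MY. p y x \<partial>\<nu>) < \<infinity>}"
  define U where "U x = {y \<in> space MY. p y x > 0}" for x
  have px: "(\<lambda>y. p y x) \<in> borel_measurable \<nu>" if [measurable]: "x \<in> space MX" for x
    by measurable
  have AE_G: "AE x in PX. x \<in> G"
  proof -
    have "(\<integral>\<^sup>+x. (\<integral>\<^sup>+y\<in>space MY. p y x \<partial>\<nu>) \<partial>PX) = emeasure PXY (space MX \<times> space MY)"
      by (subst e) (auto intro!: nn_integral_cong simp: indicator_def)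
    also have "\<dots> = 1"
      using emeasure_PXY_cylinder_X[of "space MX"] PX.emeasure_space_1 by simp
    finally have "AE x in PX. (\<integral>\<^sup>+y\<in>space MY. p y x \<partial>\<nu>) \<noteq> \<infinity>"
      using k[of "space MY"] by (intro nn_integral_PInf_AE) auto
    then show ?thesis
      by (rule AE_mp) (auto simp: G_def less_top)
  qed
  have "U ` G \<subseteq> sets PY"
    using px unfolding U_def G_def sp[symmetric] by (auto simp flip: s)
  then obtain \<C> where
    \<C>: "countable \<C>" "\<C> \<subseteq> U ` G" "\<And>W. W \<in> U ` G \<Longrightarrow> W - \<Union>\<C> \<in> null_sets PY"
    by (rule PY.countable_essential_union) blast
  obtain H where H: "countable H" "H \<subseteq> G" "\<C> = U ` H"
    using \<C>(1,2) countable_subset_image[of \<C> U G] by blast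
  define F where "F = (\<lambda>(x, n). superlevel \<nu> (\<lambda>y. p y x) n) ` (H \<times> UNIV)"
  define V where "V = \<Union>F"
  have F: "countable F" "F \<subseteq> sets \<nu>" "\<And>A. A \<in> F \<Longrightarrow> emeasure \<nu> A < \<infinity>"
  proof -
    show "countable F" unfolding F_def using H by auto
    have *: "(\<lambda>y. p y x) \<in> borel_measurable \<nu>" "(\<integral>\<^sup>+y. p y x \<partial>\<nu>) < \<infinity>" if "x \<in> H" for x
    proof -
      have x: "x \<in> G" using that H by blast
      then show "(\<lambda>y. p y x) \<in> borel_measurable \<nu>" by (intro px) (auto simp: G_def)
      have "(\<integral>\<^sup>+y. p y x \<partial>\<nu>) = (\<integral>\<^sup>+y\<in>space MY. p y x \<partial>\<nu>)"
        by (intro nn_integral_cong) (simp add: sp)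
      then show "(\<integral>\<^sup>+y. p y x \<partial>\<nu>) < \<infinity>" using x by (simp add: G_def)
    qed
    show "F \<subseteq> sets \<nu>" "\<And>A. A \<in> F \<Longrightarrow> emeasure \<nu> A < \<infinity>"
      unfolding F_def using superlevel_sets[OF *(1)] superlevel_finite[OF *] by auto
  qed
  (* V is assembled from superlevel sets because they have finite measure. *)
  have V_eq: "V = \<Union>\<C>"
  proof -
    have "V = (\<Union>x\<in>H. \<Union>n. superlevel \<nu> (\<lambda>y. p y x) n)" unfolding V_def F_def by auto
    then show ?thesis unfolding H(3) UN_superlevel U_def sp by simp
  qed
  have V\<nu>: "V \<in> sets \<nu>" unfolding V_def using F by (intro sets.countable_Union)
  then have V [measurable]: "V \<in> sets MY" using s by simp
  have sf: "sigma_finite_measure (density \<nu> (indicator V))"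
    unfolding V_def using F by (rule sigma_finite_restricted_Union)

  (* The event p(Y|X) = 0 has probability zero, and so does the event that Y lies outside V
     while p(Y|X) > 0; together they contain the event that Y lies outside V. *)
  define Z where "Z = {z \<in> space (MX \<Otimes>\<^sub>M MY). p (snd z) (fst z) = 0}"
  define N where "N = {z \<in> space (MX \<Otimes>\<^sub>M MY). p (snd z) (fst z) \<noteq> 0 \<and> snd z \<notin> V}"
  have Z [measurable]: "Z \<in> sets (MX \<Otimes>\<^sub>M MY)" and N [measurable]: "N \<in> sets (MX \<Otimes>\<^sub>M MY)"
    unfolding Z_def N_def by measurable
  have "emeasure PXY Z = (\<integral>\<^sup>+x. \<integral>\<^sup>+y. 0 \<partial>\<nu> \<partial>PX)"
    unfolding e[OF Z] by (intro nn_integral_cong) (auto simp: Z_def indicator_def)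
  then have Z0: "Z \<in> null_sets PXY" using Z by auto
  have "emeasure (PX \<Otimes>\<^sub>M PY) N = (\<integral>\<^sup>+x. emeasure PY (Pair x -` N) \<partial>PX)"
    using N by (intro PY.emeasure_pair_measure_alt) (simp add: sets_marginals)
  also have "\<dots> = (\<integral>\<^sup>+x. 0 \<partial>PX)"
  proof (rule nn_integral_cong_AE)
    show "AE x in PX. emeasure PY (Pair x -` N) = 0"
      using AE_G
    proof eventually_elim
      case (elim x)
      have "Pair x -` N = U x - \<Union>\<C>"
        using elim unfolding N_def U_def V_eq G_def
        by (auto simp: space_pair_measure zero_less_iff_neq_zero)
      then show ?case using \<C>(3)[of "U x"] elim by auto
    qed
  qed
  finally have "N \<in> null_sets (PX \<Otimes>\<^sub>M PY)"
    using N by (intro null_setsI) (simp_all add: sets_marginals)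
  then have "N \<in> null_sets PXY"
    using ac unfolding absolutely_continuous_def by blast
  then have "Z \<union> N \<in> null_sets PXY" using Z0 by (intro null_sets.Un)
  then have outside: "space MX \<times> (space MY - V) \<in> null_sets PXY"
    by (rule null_sets_subset) (auto simp: Z_def N_def space_pair_measure)

  let ?\<nu> = "density \<nu> (indicator V)"
  have dens: "(\<integral>\<^sup>+y. g y \<partial>?\<nu>) = (\<integral>\<^sup>+y. g y * indicator V y \<partial>\<nu>)"
    if "g \<in> borel_measurable MY" for g :: "'y \<Rightarrow> ennreal"
    using that V\<nu> by (subst nn_integral_density) (auto simp: measurable_cong_sets[OF s refl] ac_simps)
  have py: "(\<lambda>y. p y x) \<in> borel_measurable MY" if "x \<in> space MX" for x
    using px[OF that] by (simp add: measurable_cong_sets[OF s refl])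
  have cd: "cond_density M MY MX Y X ?\<nu> p"
    unfolding cond_density_given_X_iff
  proof (intro conjI ballI)
    fix B assume B: "B \<in> sets MY"
    have "(\<integral>\<^sup>+y\<in>B. p y x \<partial>?\<nu>) = (\<integral>\<^sup>+y\<in>B \<inter> V. p y x \<partial>\<nu>)" if "x \<in> space MX" for x
      using py[OF that] B by (subst dens) (auto intro!: nn_integral_cong simp: indicator_def)
    then show "(\<lambda>x. \<integral>\<^sup>+y\<in>B. p y x \<partial>?\<nu>) \<in> borel_measurable MX"
      using k[of "B \<inter> V"] B V by (simp cong: measurable_cong)
  next
    fix S assume S [measurable]: "S \<in> sets (MX \<Otimes>\<^sub>M MY)"
    have SV: "S \<inter> space MX \<times> V \<in> sets (MX \<Otimes>\<^sub>M MY)" by auto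
    have "S - S \<inter> space MX \<times> V \<in> null_sets PXY"
      using outside
      by (rule null_sets_subset)
        (use S SV sets.sets_into_space[OF S] in \<open>auto simp: space_pair_measure\<close>)
    then have "emeasure PXY S = emeasure PXY (S - (S - S \<inter> space MX \<times> V))"
      by (intro emeasure_Diff_null_set[symmetric]) auto
    also have "S - (S - S \<inter> space MX \<times> V) = S \<inter> space MX \<times> V" by auto
    also have "emeasure PXY (S \<inter> space MX \<times> V) =
        (\<integral>\<^sup>+x. \<integral>\<^sup>+y. p y x * indicator S (x, y) \<partial>?\<nu> \<partial>PX)"
      unfolding e[OF SV]
    proof (intro nn_integral_cong)
      fix x assume "x \<in> space PX"
      then have x [measurable]: "x \<in> space MX" by simp
      show "(\<integral>\<^sup>+y. p y x * indicator (S \<inter> space MX \<times> V) (x, y) \<partial>\<nu>) =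
          (\<integral>\<^sup>+y. p y x * indicator S (x, y) \<partial>?\<nu>)"
        using x by (subst dens) (auto intro!: nn_integral_cong simp: indicator_def)
    qed
    finally show "emeasure PXY S = (\<integral>\<^sup>+x. \<integral>\<^sup>+y. p y x * indicator S (x, y) \<partial>?\<nu> \<partial>PX)" .
  qed (use s m in auto)
  have "distributed M ?\<nu> Y (\<lambda>y. \<integral>\<^sup>+x. p y x \<partial>PX)"
    unfolding distributed_def
  proof (intro conjI)
    show "Y \<in> measurable M ?\<nu>" by measurable
    show pm: "(\<lambda>y. \<integral>\<^sup>+x. p y x \<partial>PX) \<in> borel_measurable ?\<nu>" by measurable
    show "distr M ?\<nu> Y = density ?\<nu> (\<lambda>y. \<integral>\<^sup>+x. p y x \<partial>PX)"
    proof (rule measure_eqI)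
      fix B assume "B \<in> sets (distr M ?\<nu> Y)"
      then have B [measurable]: "B \<in> sets MY" using s by simp
      have "emeasure (distr M ?\<nu> Y) B = emeasure PY B"
        using distr_cong[OF refl, of ?\<nu> MY M Y Y] s by simp
      also have "\<dots> = emeasure PXY (space MX \<times> B)"
        using emeasure_PXY_cylinder_Y[OF B] by simp
      also have "\<dots> = (\<integral>\<^sup>+y. \<integral>\<^sup>+x. p y x * indicator (space MX \<times> B) (x, y) \<partial>PX \<partial>?\<nu>)"
        by (rule cond_density_given_X_Fubini[OF sf cd]) simp
      also have "\<dots> = (\<integral>\<^sup>+y. (\<integral>\<^sup>+x. p y x \<partial>PX) * indicator B y \<partial>?\<nu>)"
        by (intro nn_integral_cong) (auto simp: indicator_def intro!: nn_integral_cong)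
      also have "\<dots> = emeasure (density ?\<nu> (\<lambda>y. \<integral>\<^sup>+x. p y x \<partial>PX)) B"
        using pm B s by (subst emeasure_density) auto
      finally show "emeasure (distr M ?\<nu> Y) B = emeasure (density ?\<nu> (\<lambda>y. \<integral>\<^sup>+x. p y x \<partial>PX)) B" .
    qed simp
  qed
  then have "localizes_density M MX MY X Y \<nu> p V"
    unfolding localizes_density_def Let_def using V sf cd by blast
  then show thesis by (rule that)
qed

text \<open>
  Bayes' formula is a change of the order of integration: on \<open>0 < p(y) < \<infinity>\<close> the factor \<open>p(y)\<close>
  that comes from the density of \<open>Y\<close> cancels the denominator.  The set \<open>p(y) = \<infinity>\<close> is
  \<open>\<nu>\<close>-null, and where \<open>p(y) = 0\<close> the numerator vanishes as well.
\<close>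

lemma bayes_cond_density:
  assumes \<nu>: "sigma_finite_measure \<nu>" and p: "cond_density M MY MX Y X \<nu> p"
    and d: "distributed M \<nu> Y (\<lambda>y. \<integral>\<^sup>+x. p y x \<partial>PX)"
  shows "cond_density M MX MY X Y PX (\<lambda>x y. bayes_quotient (p y x) (\<integral>\<^sup>+x. p y x \<partial>PX))"
proof -
  interpret \<nu>: sigma_finite_measure \<nu> by fact
  from p have s [measurable_cong]: "sets \<nu> = sets MY"
    and m [measurable]: "(\<lambda>(y, x). p y x) \<in> borel_measurable (MY \<Otimes>\<^sub>M MX)"
    unfolding cond_density_given_X_iff by auto
  let ?p = "\<lambda>y. \<integral>\<^sup>+x. p y x \<partial>PX"
  have pm [measurable]: "?p \<in> borel_measurable MY" by measurable
  have PY: "density \<nu> ?p = PY"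
    using d distr_cong[OF refl s, of M Y Y] unfolding distributed_def by auto
  have "(\<integral>\<^sup>+y. ?p y \<partial>\<nu>) = emeasure (density \<nu> ?p) (space \<nu>)"
    by (subst emeasure_density) (auto intro!: nn_integral_cong)
  also have "\<dots> = 1"
    unfolding PY using PY.emeasure_space_1 sets_eq_imp_space_eq[OF s] by simp
  finally have fin: "AE y in \<nu>. ?p y \<noteq> \<infinity>"
    by (intro nn_integral_PInf_AE) auto
  have qm [measurable]:
    "(\<lambda>(x, y). bayes_quotient (p y x) (?p y)) \<in> borel_measurable (MX \<Otimes>\<^sub>M MY)"
    by measurable
  show ?thesis
    unfolding cond_density_iff[OF X Y]
  proof (intro conjI ballI)
    show "(\<lambda>y. \<integral>\<^sup>+x\<in>S. bayes_quotient (p y x) (?p y) \<partial>PX) \<in> borel_measurable MY"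
      if [measurable]: "S \<in> sets MX" for S
      by measurable
    fix S assume S [measurable]: "S \<in> sets (MX \<Otimes>\<^sub>M MY)"
    let ?n = "\<lambda>y. \<integral>\<^sup>+x. p y x * indicator S (x, y) \<partial>PX"
    have "(\<integral>\<^sup>+y. \<integral>\<^sup>+x. bayes_quotient (p y x) (?p y) * indicator S (x, y) \<partial>PX \<partial>PY) =
        (\<integral>\<^sup>+y. bayes_quotient (?n y) (?p y) \<partial>PY)"
    proof (intro nn_integral_cong)
      fix y assume "y \<in> space PY"
      then have [measurable]: "y \<in> space MY" by simp
      show "(\<integral>\<^sup>+x. bayes_quotient (p y x) (?p y) * indicator S (x, y) \<partial>PX) =
          bayes_quotient (?n y) (?p y)"
        unfolding bayes_quotient_indicator by (rule nn_integral_bayes_quotient) measurable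
    qed
    also have "\<dots> = (\<integral>\<^sup>+y. ?p y * bayes_quotient (?n y) (?p y) \<partial>\<nu>)"
      unfolding PY[symmetric] by (rule nn_integral_density) measurable
    also have "\<dots> = (\<integral>\<^sup>+y. ?n y \<partial>\<nu>)"
    proof (rule nn_integral_cong_AE)
      show "AE y in \<nu>. ?p y * bayes_quotient (?n y) (?p y) = ?n y"
        using fin
      proof eventually_elim
        case (elim y)
        have "?n y \<le> ?p y" by (intro nn_integral_mono) (auto simp: indicator_def)
        then show ?case using elim by (rule mult_bayes_quotient)
      qed
    qed
    also have "\<dots> = emeasure PXY S"
      by (rule cond_density_given_X_Fubini[OF \<nu> p S, symmetric])
    finally show "emeasure PXY S =
      (\<integral>\<^sup>+y. \<integral>\<^sup>+x. bayes_quotient (p y x) (?p y) * indicator S (x, y) \<partial>PX \<partial>PY)" ..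
  qed (use qm in auto)
qed

lemma bayes_kernel_of_cond_density:
  assumes m: "(\<lambda>(y, x). p y x) \<in> borel_measurable (MY \<Otimes>\<^sub>M MX)"
    and b: "cond_density M MX MY X Y PX (\<lambda>x y. bayes_quotient (p y x) (\<integral>\<^sup>+x. p y x \<partial>PX))"
  obtains \<kappa> where "cond_distribution M MX MY X Y \<kappa>"
    "\<And>y S. y \<in> space MY \<Longrightarrow> S \<in> sets MX \<Longrightarrow>
      emeasure (\<kappa> y) S = bayes_quotient (\<integral>\<^sup>+x\<in>S. p y x \<partial>PX) (\<integral>\<^sup>+x. p y x \<partial>PX)"
proof -
  note [measurable] = m
  obtain \<kappa> where \<kappa>: "cond_distribution M MX MY X Y \<kappa>"
    "\<And>y S. y \<in> space MY \<Longrightarrow> S \<in> sets MX \<Longrightarrow>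
      emeasure (\<kappa> y) S = (\<integral>\<^sup>+x\<in>S. bayes_quotient (p y x) (\<integral>\<^sup>+x. p y x \<partial>PX) \<partial>PX)"
    using b unfolding cond_density_def by auto
  have "emeasure (\<kappa> y) S = bayes_quotient (\<integral>\<^sup>+x\<in>S. p y x \<partial>PX) (\<integral>\<^sup>+x. p y x \<partial>PX)"
    if [measurable]: "y \<in> space MY" "S \<in> sets MX" for y S
    unfolding \<kappa>(2)[OF that] bayes_quotient_indicator
    by (rule nn_integral_bayes_quotient) measurable
  with \<kappa>(1) show thesis by (rule that)
qed

text \<open>
  Integrating against \<open>PX\<close> is integrating against \<open>f\<close> times \<open>\<mu>\<close>, so the kernel given by Bayes'
  formula for distributions already has the density given by Bayes' formula for densities.
\<close>

lemma bayes_kernel_imp_cond_density: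
  assumes m: "(\<lambda>(y, x). p y x) \<in> borel_measurable (MY \<Otimes>\<^sub>M MX)"
    and \<kappa>: "cond_distribution M MX MY X Y \<kappa>"
      "\<And>y S. y \<in> space MY \<Longrightarrow> S \<in> sets MX \<Longrightarrow>
        emeasure (\<kappa> y) S = bayes_quotient (\<integral>\<^sup>+x\<in>S. p y x \<partial>PX) (\<integral>\<^sup>+x. p y x \<partial>PX)"
    and s: "sets \<mu> = sets MX" and d: "distributed M \<mu> X f"
  shows "cond_density M MX MY X Y \<mu>
    (\<lambda>x y. bayes_quotient (p y x * f x) (\<integral>\<^sup>+x'. p y x' * f x' \<partial>\<mu>))"
proof -
  note [measurable] = m and [measurable_cong] = s
  have f': "f \<in> borel_measurable \<mu>" and PX: "density \<mu> f = PX"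
    using d distr_cong[OF refl s, of M X X] unfolding distributed_def by auto
  have f [measurable]: "f \<in> borel_measurable MX"
    using f' by (simp add: measurable_cong_sets[OF s refl])
  have int: "(\<integral>\<^sup>+x. g x * f x \<partial>\<mu>) = integral\<^sup>N PX g" if "g \<in> borel_measurable MX" for g
    unfolding PX[symmetric] using that f'
    by (subst nn_integral_density) (auto simp: ac_simps measurable_cong_sets[OF s refl])
  have den: "(\<integral>\<^sup>+x'. p y x' * f x' \<partial>\<mu>) = (\<integral>\<^sup>+x. p y x \<partial>PX)" if [measurable]: "y \<in> space MY" for y
    by (rule int) measurable
  have "(\<lambda>(x, y). bayes_quotient (p y x * f x) (\<integral>\<^sup>+x. p y x \<partial>PX))
      \<in> borel_measurable (MX \<Otimes>\<^sub>M MY)"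
    by measurable
  also have "?this \<longleftrightarrow> (\<lambda>(x, y). bayes_quotient (p y x * f x) (\<integral>\<^sup>+x'. p y x' * f x' \<partial>\<mu>))
      \<in> borel_measurable (MX \<Otimes>\<^sub>M MY)"
    by (rule measurable_cong) (auto simp: space_pair_measure den)
  finally have meas: "(\<lambda>(x, y). bayes_quotient (p y x * f x) (\<integral>\<^sup>+x'. p y x' * f x' \<partial>\<mu>))
      \<in> borel_measurable (MX \<Otimes>\<^sub>M MY)" .
  have "emeasure (\<kappa> y) S =
      (\<integral>\<^sup>+x\<in>S. bayes_quotient (p y x * f x) (\<integral>\<^sup>+x'. p y x' * f x' \<partial>\<mu>) \<partial>\<mu>)"
    if y [measurable]: "y \<in> space MY" and S [measurable]: "S \<in> sets MX" for y S
  proof -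
    have "(\<integral>\<^sup>+x\<in>S. bayes_quotient (p y x * f x) (\<integral>\<^sup>+x. p y x \<partial>PX) \<partial>\<mu>) =
        bayes_quotient (\<integral>\<^sup>+x. p y x * f x * indicator S x \<partial>\<mu>) (\<integral>\<^sup>+x. p y x \<partial>PX)"
      unfolding bayes_quotient_indicator by (rule nn_integral_bayes_quotient) measurable
    also have "(\<integral>\<^sup>+x. p y x * f x * indicator S x \<partial>\<mu>) = (\<integral>\<^sup>+x. (p y x * indicator S x) * f x \<partial>\<mu>)"
      by (simp add: ac_simps)
    also have "\<dots> = (\<integral>\<^sup>+x\<in>S. p y x \<partial>PX)"
      by (rule int) measurable
    finally show ?thesis unfolding den[OF y] \<kappa>(2)[OF y S] ..
  qed
  then show ?thesis
    unfolding cond_density_def using s meas \<kappa>(1) by blast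
qed

text \<open>
  Where \<open>p(y) > 0\<close>, \<open>\<nu>\<close> cannot charge the complement of \<open>V\<close>: otherwise semifiniteness provides
  a set of finite positive measure there.  It is negligible for \<open>Y\<close>, which lives on \<open>V\<close>, but on
  a set of finite measure \<open>p(y)\<close> does integrate to the probability of \<open>Y\<close>.
\<close>

lemma semifinite_imp_marginal_density:
  assumes p: "cond_density M MY MX Y X \<nu> p" and V: "localizes_density M MX MY X Y \<nu> p V"
    and sf: "semifinite \<nu>"
  shows "distributed M \<nu> Y (\<lambda>y. \<integral>\<^sup>+x. p y x \<partial>PX)"
proof -
  let ?p = "\<lambda>y. \<integral>\<^sup>+x. p y x \<partial>PX" and ?\<nu> = "density \<nu> (indicator V)"
  from p have s [measurable_cong]: "sets \<nu> = sets MY"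
    and m [measurable]: "(\<lambda>(y, x). p y x) \<in> borel_measurable (MY \<Otimes>\<^sub>M MX)"
    and e: "\<And>S. S \<in> sets (MX \<Otimes>\<^sub>M MY) \<Longrightarrow>
      emeasure PXY S = (\<integral>\<^sup>+x. \<integral>\<^sup>+y. p y x * indicator S (x, y) \<partial>\<nu> \<partial>PX)"
    unfolding cond_density_given_X_iff by auto
  have sp: "space \<nu> = space MY" using s by (rule sets_eq_imp_space_eq)
  have Vs [measurable]: "V \<in> sets MY" and d: "distributed M ?\<nu> Y ?p"
    using V unfolding localizes_density_def Let_def by auto
  have pm [measurable]: "?p \<in> borel_measurable MY" by measurable
  have "sets ?\<nu> = sets MY" using s by simp
  then have PY: "PY = density ?\<nu> ?p"
    using d distr_cong[OF refl, of ?\<nu> MY M Y Y] unfolding distributed_def by auto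
  have PYV: "PY = density \<nu> (\<lambda>y. indicator V y * ?p y)"
    unfolding PY by (rule density_density_eq) measurable
  let ?N = "{y \<in> space MY. y \<notin> V \<and> ?p y > 0}"
  have N: "?N \<in> sets MY" by measurable
  have "emeasure \<nu> ?N = 0"
  proof (rule ccontr)
    assume "emeasure \<nu> ?N \<noteq> 0"
    then obtain B where "B \<in> sets \<nu>" and BN: "B \<subseteq> ?N" and B0: "0 < emeasure \<nu> B"
      and Bfin: "emeasure \<nu> B < \<infinity>"
      using sf N s unfolding semifinite_def zero_less_iff_neq_zero by blast
    then have B [measurable]: "B \<in> sets MY" using s by simp
    let ?\<nu>B = "density \<nu> (indicator B)"
    have dens: "(\<integral>\<^sup>+y. g y * indicator B y \<partial>\<nu>) = (\<integral>\<^sup>+y. g y \<partial>?\<nu>B)"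
      if "g \<in> borel_measurable MY" for g :: "'y \<Rightarrow> ennreal"
      using that by (subst nn_integral_density) (auto simp: measurable_cong_sets[OF s refl] ac_simps)
    interpret \<nu>B: finite_measure ?\<nu>B
      by (rule finite_measureI) (use Bfin B sp in \<open>auto simp: emeasure_restricted simp flip: sp\<close>)
    interpret P: pair_sigma_finite PX ?\<nu>B ..
    have "emeasure PY B = (\<integral>\<^sup>+y. indicator V y * ?p y * indicator B y \<partial>\<nu>)"
      unfolding PYV by (rule emeasure_density) measurable
    also have "\<dots> = (\<integral>\<^sup>+y. 0 \<partial>\<nu>)"
      using BN by (intro nn_integral_cong) (auto simp: indicator_def)
    finally have "emeasure PXY (space MX \<times> B) = 0"
      using emeasure_PXY_cylinder_Y[OF B] by simp
    moreover have "emeasure PXY (space MX \<times> B) = (\<integral>\<^sup>+x. \<integral>\<^sup>+y. p y x \<partial>?\<nu>B \<partial>PX)"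
      by (subst e) (auto intro!: nn_integral_cong simp: indicator_def simp flip: dens)
    moreover have "\<dots> = (\<integral>\<^sup>+y. ?p y \<partial>?\<nu>B)"
      by (rule P.Fubini'[symmetric]) measurable
    moreover have "\<dots> = (\<integral>\<^sup>+y. ?p y * indicator B y \<partial>\<nu>)"
      by (rule dens[symmetric]) measurable
    ultimately have "(\<integral>\<^sup>+y. ?p y * indicator B y \<partial>\<nu>) = 0" by simp
    then have "AE y in \<nu>. ?p y * indicator B y = 0"
      by (subst (asm) nn_integral_0_iff_AE) auto
    then have "AE y in \<nu>. y \<notin> B"
      by eventually_elim (use BN in \<open>auto simp: indicator_def\<close>)
    then have "emeasure \<nu> B = 0"
      using B s AE_iff_null_sets[of B \<nu>] by auto
    with B0 show False by simp
  qed
  then have "?N \<in> null_sets \<nu>" using N s by auto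
  from AE_not_in[OF this] have "AE y in \<nu>. indicator V y * ?p y = ?p y"
    by (rule AE_mp) (auto intro!: AE_I2 simp: sp indicator_def zero_less_iff_neq_zero)
  then have "PY = density \<nu> ?p"
    unfolding PYV by (intro density_cong) auto
  then show ?thesis
    unfolding distributed_def using distr_cong[OF refl s, of M Y Y] by auto
qed

end


section \<open>The equivalences\<close>

theorem theorem2:
  fixes M :: "'w measure" and MX :: "'x measure" and MY :: "'y measure"
    and X :: "'w \<Rightarrow> 'x" and Y :: "'w \<Rightarrow> 'y"
    and \<nu> :: "'y measure" and p :: "'y \<Rightarrow> 'x \<Rightarrow> ennreal"
  assumes "prob_space M"
    and "X \<in> measurable M MX" and "Y \<in> measurable M MY"
    and "sets \<nu> = sets MY"
    and "cond_density M MY MX Y X \<nu> p"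
  defines "PX \<equiv> distr M MX X" and "PY \<equiv> distr M MY Y"
    and "PXY \<equiv> distr M (MX \<Otimes>\<^sub>M MY) (\<lambda>\<omega>. (X \<omega>, Y \<omega>))"
  defines "a1 \<equiv> \<exists>(\<mu> :: 'x measure) (\<nu>0 :: 'y measure) f.
      sets \<mu> = sets MX \<and> sets \<nu>0 = sets MY \<and>
      distributed M (arb_prod \<mu> \<nu>0) (\<lambda>\<omega>. (X \<omega>, Y \<omega>)) f"
    and "a2 \<equiv> absolutely_continuous (arb_prod PX PY) PXY"
    and "a3 \<equiv> \<exists>\<mu> q. sigma_finite_measure \<mu> \<and> cond_density M MX MY X Y \<mu> q"
    and "a4 \<equiv> \<exists>\<kappa>. cond_distribution M MX MY X Y \<kappa> \<and>
      (\<forall>y\<in>space MY. absolutely_continuous PX (\<kappa> y))"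
    and "a5 \<equiv> \<exists>\<kappa> \<mu> f. cond_distribution M MX MY X Y \<kappa> \<and>
      sets \<mu> = sets MX \<and> distributed M \<mu> X f \<and>
      (\<forall>y\<in>space MY. absolutely_continuous \<mu> (\<kappa> y))"
    and "b \<equiv> \<exists>V. localizes_density M MX MY X Y \<nu> p V"
    and "c \<equiv> \<exists>\<kappa>. cond_distribution M MX MY X Y \<kappa> \<and>
      (\<forall>y\<in>space MY. \<forall>S\<in>sets MX.
         emeasure (\<kappa> y) S = bayes_quotient (\<integral>\<^sup>+x\<in>S. p y x \<partial>PX) (\<integral>\<^sup>+x. p y x \<partial>PX))"
    and "c' \<equiv> \<forall>\<mu> f. sets \<mu> = sets MX \<and> distributed M \<mu> X f \<longrightarrow>
      cond_density M MX MY X Y \<mu>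
        (\<lambda>x y. bayes_quotient (p y x * f x) (\<integral>\<^sup>+x'. p y x' * f x' \<partial>\<mu>))"
  shows "(a1 \<longleftrightarrow> a2) \<and> (a2 \<longleftrightarrow> a3) \<and> (a3 \<longleftrightarrow> a4) \<and> (a4 \<longleftrightarrow> a5) \<and>
    (a5 \<longleftrightarrow> b) \<and> (b \<longleftrightarrow> c) \<and> (c \<longleftrightarrow> c') \<and>
    (\<forall>V. localizes_density M MX MY X Y \<nu> p V \<and> semifinite \<nu> \<longrightarrow>
       distributed M \<nu> Y (\<lambda>y. \<integral>\<^sup>+x. p y x \<partial>PX))"
proof -
  interpret random_pair M MX MY X Y
    using assms(1-3) by (simp add: random_pair_def random_pair_axioms_def)
  note p = assms(5)
  have m: "(\<lambda>(y, x). p y x) \<in> borel_measurable (MY \<Otimes>\<^sub>M MX)"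
    using p by (simp add: cond_density_def)
  have prod: "arb_prod PX PY = distr M MX X \<Otimes>\<^sub>M distr M MY Y"
    unfolding PX_def PY_def
    by (intro arb_prod_eq_pair_measure PX.sigma_finite_measure_axioms PY.sigma_finite_measure_axioms)
  have a2: "a2 \<longleftrightarrow> absolutely_continuous (distr M MX X \<Otimes>\<^sub>M distr M MY Y) PXY"
    unfolding a2_def prod ..
  have X1: "distributed M PX X (\<lambda>_. 1)"
    unfolding distributed_def PX_def by (auto simp: density_1 intro: distr_cong)
  have 12: a2 if a1
    using that joint_density_imp_abs_cont unfolding a1_def a2 PXY_def by blast
  have 21: a1 if 2: a2
  proof -
    obtain f where f: "f \<in> borel_measurable (MX \<Otimes>\<^sub>M MY)"
      "density (distr M MX X \<Otimes>\<^sub>M distr M MY Y) f = PXY"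
      using 2 unfolding a2 PXY_def by (rule abs_cont_imp_joint_density)
    have "distributed M (distr M MX X \<Otimes>\<^sub>M distr M MY Y) (\<lambda>\<omega>. (X \<omega>, Y \<omega>)) f"
      unfolding distributed_def f(2) PXY_def
      using f(1) by (auto intro!: distr_cong simp: sets_marginals measurable_cong_sets[OF sets_marginals refl])
    then show a1
      unfolding a1_def prod[symmetric] using assms(2,3)
      by (intro exI[of _ PX] exI[of _ PY] exI[of _ f]) (auto simp: PX_def PY_def)
  qed
  have 23: a3 if a2
    using that abs_cont_imp_cond_density PX.sigma_finite_measure_axioms
    unfolding a2 PXY_def a3_def by blast
  have 31: a1 if 3: a3
  proof -
    obtain \<mu> q where \<mu>: "sigma_finite_measure \<mu>" and q: "cond_density M MX MY X Y \<mu> q"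
      using 3 unfolding a3_def by blast
    have "sets \<mu> = sets MX" using q by (simp add: cond_density_def)
    moreover have "sets (distr M MY Y) = sets MY" by simp
    ultimately show a1
      unfolding a1_def using sigma_finite_cond_density_imp_joint_density[OF \<mu> q] by blast
  qed
  have 24: a4 if 2: a2
  proof -
    obtain q where q: "cond_density M MX MY X Y (distr M MX X) q"
      using 2 unfolding a2 PXY_def by (rule abs_cont_imp_cond_density)
    obtain \<kappa> where "cond_distribution M MX MY X Y \<kappa>"
      "\<And>y. y \<in> space MY \<Longrightarrow> absolutely_continuous (distr M MX X) (\<kappa> y)"
      using cond_density_kernel_abs_cont[OF q] by blast
    then show a4 unfolding a4_def PX_def by blast
  qed
  have 45: a5 if a4
  proof -
    have "sets PX = sets MX" by (simp add: PX_def)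
    then show a5
      using that X1 unfolding a4_def a5_def by blast
  qed
  have 52: a2 if a5
    using that dominated_kernel_imp_abs_cont unfolding a5_def a2 PXY_def by blast
  have a2b: b if a2
    using that abs_cont_imp_localizes[OF p] unfolding a2 PXY_def b_def by blast
  have b1: a1 and bc: c if b
  proof -
    obtain V where V: "localizes_density M MX MY X Y \<nu> p V"
      using \<open>b\<close> unfolding b_def by blast
    define \<nu>' where "\<nu>' = density \<nu> (indicator V)"
    have \<nu>': "sigma_finite_measure \<nu>'" "cond_density M MY MX Y X \<nu>' p"
      "distributed M \<nu>' Y (\<lambda>y. \<integral>\<^sup>+x. p y x \<partial>distr M MX X)"
      using V unfolding localizes_density_def Let_def \<nu>'_def by blast+
    have "sets \<nu>' = sets MY" using assms(4) by (simp add: \<nu>'_def)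
    moreover have "sets (distr M MX X) = sets MX" by simp
    ultimately show a1
      unfolding a1_def using sigma_finite_cond_density_given_X_imp_joint_density[OF \<nu>'(1,2)] by blast
    obtain \<kappa> where "cond_distribution M MX MY X Y \<kappa>"
      "\<And>y S. y \<in> space MY \<Longrightarrow> S \<in> sets MX \<Longrightarrow> emeasure (\<kappa> y) S =
        bayes_quotient (\<integral>\<^sup>+x\<in>S. p y x \<partial>distr M MX X) (\<integral>\<^sup>+x. p y x \<partial>distr M MX X)"
      using bayes_kernel_of_cond_density[OF m bayes_cond_density[OF \<nu>']] by blast
    then show c
      unfolding c_def PX_def by blast
  qed
  have cc': c' if c
    using that bayes_kernel_imp_cond_density[OF m] unfolding c_def c'_def PX_def by blast
  (* Take PX itself as the reference measure, where X has the marginal density 1. *)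
  have c'3: a3 if c'
  proof -
    have "sets PX = sets MX" by (simp add: PX_def)
    then show a3
      using that X1 PX.sigma_finite_measure_axioms unfolding c'_def a3_def PX_def by blast
  qed
  have "\<forall>V. localizes_density M MX MY X Y \<nu> p V \<and> semifinite \<nu> \<longrightarrow>
      distributed M \<nu> Y (\<lambda>y. \<integral>\<^sup>+x. p y x \<partial>PX)"
    unfolding PX_def using semifinite_imp_marginal_density[OF p] by blast
  with 12 21 23 31 24 45 52 a2b b1 bc cc' c'3 show ?thesis
    by blast
qed

end
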